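(* Let $P=\{\boldsymbol x\in\mathbb R^n:\langle\boldsymbol a_i,\boldsymbol x\rangle+b_i\ge0,\ i=1,\ldots,m\}$ be an $n$-dimensional convex polytope given by a generic presentation (possibly with redundant inequalities), let $\mathcal Z_P$ be the corresponding moment-angle manifold, and let $\Sigma_P$, $\mathcal K_P$ be the normal fan and its underlying simplicial complex on $[m]$. If $\dim\mathcal Z_P=m+n$ is even, then $\mathcal Z_P$ admits a complex structure as the quotient $U(\mathcal K_P)/C_{\Psi,\Sigma_P}$. If $m+n$ is odd, then the product $\mathcal Z_P\times S^1$ admits such a structure (namely, as the corresponding quotient for the presentation of $P$ by $m+1$ inequalities obtained by adding the redundant inequality $1\ge0$, i.e. $\boldsymbol a_{m+1}=0$, $b_{m+1}=1$).
   Context: The presentation is generic if at every point of $P$ at most $n$ of the hyperplanes $H_i=\{\boldsymbol x:\langle\boldsymbol a_i,\boldsymbol x\rangle+b_i=0\}$ meet. An inequality is redundant if removing it does not change $P$. For a generic presentation, each $F_i=H_i\cap P$ is a facet of $P$ or empty, the latter exactly for redundant inequalities. The map $i_P\colon\mathbb R^n\to\mathbb R^m$, $\boldsymbol x\mapsto(\langle\boldsymbol a_i,\boldsymbol x\rangle+b_i)_{i=1}^m$, is injective, and $\mathcal Z_P=\{\boldsymbol z\in\mathbb C^m:(|z_1|^2,\ldots,|z_m|^2)\in i_P(P)\}$, with the coordinatewise action of $\mathbb T^m$. The complex $\mathcal K_P$ on $[m]$ consists of all $I\subset[m]$ with $\bigcap_{i\in I}F_i\ne\varnothing$ (and $\varnothing\in\mathcal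 K_P$). The normal fan $\Sigma_P$ consists of the cones spanned by $\{\boldsymbol a_i:i\in I\}$, $I\in\mathcal K_P$; it is a complete simplicial fan. Indices of redundant inequalities are treated as 'empty' one-dimensional cones (ghost vertices of $\mathcal K_P$), with the corresponding generator set to $0$ below. For $W\subset X$ put $(X,W)^{\mathcal K}=\bigcup_{I\in\mathcal K}\{(x_1,\ldots,x_m)\in X^m:x_j\in W\text{ for }j\notin I\}$. Set $\mathcal Z_{\mathcal K}=(\mathbb D,\mathbb T)^{\mathcal K}$ (closed unit disc, unit circle) and $U(\mathcal K)=(\mathbb C,\mathbb C^\times)^{\mathcal K}\subset\mathbb C^m$. The spaces $\mathcal Z_P$ and $\mathcal Z_{\mathcal K_P}$ are $\mathbb T^m$-equivariantly homeomorphic and are identified; either is called the moment-angle manifold of $P$. Let $\Lambda_{\mathbb R}\colon\mathbb R^m\to\mathbb R^n$ be the linear map sending $\boldsymbol e_i$ to $\boldsymbol a_i$ (to $0$ if $i$ is a ghost vertex). If $m-n=2\ell$, choose a $\mathbb C$-linear map $\Psi\colon\mathbb C^\ell\to\mathbb C^m$ such that $\mathrm{Re}\circ\Psi\colon\mathbb C^\ell\to\mathbb R^m$ is injective and $\Lambda_{\mathbb R}\circ\mathrm{Re}\circ\Psi=0$ ($\mathrm{Re}$ is the coordinatewise real part). Then $C_{\Psi,\Sigma_P}=\exp\Psi(\mathbb C^\ell)\subset(\mathbb C^\times)^m$ (componentwise exponential) acts on $U(\mathcal K_P)$ by coordinatewise multiplication. 'Complex structure as the quotient' means that $U(\mathcal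 K_P)/C_{\Psi,\Sigma_P}$ is a complex manifold (the quotient of the open set $U(\mathcal K_P)\subset\mathbb C^m$ by a free and proper holomorphic action) which is homeomorphic to $\mathcal Z_P$ (identified with $\mathcal Z_{\mathcal K_P}$), the complex structure being transported along this homeomorphism. *)

theory Defs
  imports "HOL-Analysis.Analysis"
begin

section \<open>Polytope presentations\<close>

text \<open>
  Euclidean \<open>n\<close>-space is an \<open>n\<close>-dimensional linear subspace \<open>E\<close> of a type of class
  \<open>euclidean_space\<close>, with the induced inner product; \<open>E = UNIV\<close> is the literal case, and
  \<open>E = {0}\<close> is \<open>n = 0\<close>, which no \<open>euclidean_space\<close> type provides.
  The inequalities are indexed by the finite type \<open>'m\<close>, so \<open>m = CARD('m)\<close>.
\<close>

definition presented_polytope ::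
    "'v::euclidean_space set \<Rightarrow> ('m \<Rightarrow> 'v) \<Rightarrow> ('m \<Rightarrow> real) \<Rightarrow> 'v set" where
  "presented_polytope E a b = {x \<in> E. \<forall>i. a i \<bullet> x + b i \<ge> 0}"

definition pres_hyperplane ::
    "'v::euclidean_space set \<Rightarrow> ('m \<Rightarrow> 'v) \<Rightarrow> ('m \<Rightarrow> real) \<Rightarrow> 'm \<Rightarrow> 'v set" where
  "pres_hyperplane E a b i = {x \<in> E. a i \<bullet> x + b i = 0}"

definition pres_face ::
    "'v::euclidean_space set \<Rightarrow> ('m \<Rightarrow> 'v) \<Rightarrow> ('m \<Rightarrow> real) \<Rightarrow> 'm \<Rightarrow> 'v set" where
  "pres_face E a b i = pres_hyperplane E a b i \<inter> presented_polytope E a b"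

text \<open>Hyperplanes are counted by their indices, so a repeated inequality counts twice.\<close>

definition generic_presentation ::
    "'v::euclidean_space set \<Rightarrow> ('m::finite \<Rightarrow> 'v) \<Rightarrow> ('m \<Rightarrow> real) \<Rightarrow> bool" where
  "generic_presentation E a b \<longleftrightarrow>
     (\<forall>x \<in> presented_polytope E a b. card {i. x \<in> pres_hyperplane E a b i} \<le> dim E)"

definition add_trivial_normal :: "('m \<Rightarrow> 'v::zero) \<Rightarrow> 'm option \<Rightarrow> 'v" where
  "add_trivial_normal a = case_option 0 a"

definition add_trivial_const :: "('m \<Rightarrow> real) \<Rightarrow> 'm option \<Rightarrow> real" where
  "add_trivial_const b = case_option 1 b"

section \<open>Moment-angle manifold, simplicial complex, polyhedral product\<close>

definition polytope_map ::
    "('m \<Rightarrow> 'v::euclidean_space) \<Rightarrow> ('m::finite \<Rightarrow> real) \<Rightarrow> 'v \<Rightarrow> real^'m" where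
  "polytope_map a b x = (\<chi> i. a i \<bullet> x + b i)"

definition moment_angle_manifold ::
    "'v::euclidean_space set \<Rightarrow> ('m::finite \<Rightarrow> 'v) \<Rightarrow> ('m \<Rightarrow> real) \<Rightarrow> (complex^'m) set" where
  "moment_angle_manifold E a b =
     {z. (\<chi> i. (cmod (z $ i))\<^sup>2) \<in> polytope_map a b ` presented_polytope E a b}"

text \<open>The empty set is a member, since \<open>\<Inter>i\<in>{}. F i = UNIV\<close>.\<close>

definition polytope_complex ::
    "'v::euclidean_space set \<Rightarrow> ('m \<Rightarrow> 'v) \<Rightarrow> ('m \<Rightarrow> real) \<Rightarrow> 'm set set" where
  "polytope_complex E a b = {I. (\<Inter>i\<in>I. pres_face E a b i) \<noteq> {}}"

definition polyhedral_product ::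
    "'x set \<Rightarrow> 'x set \<Rightarrow> 'm set set \<Rightarrow> ('x^'m::finite) set" where
  "polyhedral_product X W K = (\<Union>I\<in>K. {x. (\<forall>j. x $ j \<in> X) \<and> (\<forall>j. j \<notin> I \<longrightarrow> x $ j \<in> W)})"

definition coord_arrangement_complement :: "'m set set \<Rightarrow> (complex^'m::finite) set" where
  "coord_arrangement_complement K = polyhedral_product UNIV (- {0}) K"

section \<open>The group acting\<close>

text \<open>The normal fan enters through its generators, which are \<open>0\<close> at ghost vertices.\<close>

definition fan_generator ::
    "'v::euclidean_space set \<Rightarrow> ('m \<Rightarrow> 'v) \<Rightarrow> ('m \<Rightarrow> real) \<Rightarrow> 'm \<Rightarrow> 'v" where
  "fan_generator E a b i = (if {i} \<in> polytope_complex E a b then a i else 0)"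

definition fan_map ::
    "'v::euclidean_space set \<Rightarrow> ('m::finite \<Rightarrow> 'v) \<Rightarrow> ('m \<Rightarrow> real) \<Rightarrow> real^'m \<Rightarrow> 'v" where
  "fan_map E a b y = (\<Sum>i\<in>UNIV. (y $ i) *\<^sub>R fan_generator E a b i)"

definition Re_vec :: "complex^'m \<Rightarrow> real^'m::finite" where
  "Re_vec z = (\<chi> i. Re (z $ i))"

definition exp_vec :: "complex^'m \<Rightarrow> complex^'m::finite" where
  "exp_vec z = (\<chi> i. exp (z $ i))"

text \<open>\<open>Vector_Spaces.linear (*s) (*s)\<close> is complex linearity.\<close>

definition admissible_Psi ::
    "'v::euclidean_space set \<Rightarrow> ('m::finite \<Rightarrow> 'v) \<Rightarrow> ('m \<Rightarrow> real) \<Rightarrow>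
     (complex^'l::finite \<Rightarrow> complex^'m) \<Rightarrow> bool" where
  "admissible_Psi E a b \<Psi> \<longleftrightarrow>
     Vector_Spaces.linear (*s) (*s) \<Psi> \<and>
     inj (Re_vec \<circ> \<Psi>) \<and>
     (\<forall>w. fan_map E a b (Re_vec (\<Psi> w)) = 0)"

section \<open>Holomorphic maps and complex manifolds\<close>

text \<open>\<open>s1\<close> and \<open>s2\<close> are the complex scalar multiplications of source and target;
  the notion is meant for open \<open>S\<close>.\<close>

definition complex_derivative ::
    "(complex \<Rightarrow> 'x \<Rightarrow> 'x) \<Rightarrow> (complex \<Rightarrow> 'y \<Rightarrow> 'y) \<Rightarrow>
     ('x::real_normed_vector \<Rightarrow> 'y::real_normed_vector) \<Rightarrow> ('x \<Rightarrow> 'y) \<Rightarrow> 'x \<Rightarrow> bool" where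
  "complex_derivative s1 s2 f D x \<longleftrightarrow> (f has_derivative D) (at x) \<and> Vector_Spaces.linear s1 s2 D"

definition holomorphic_map_on ::
    "(complex \<Rightarrow> 'x \<Rightarrow> 'x) \<Rightarrow> (complex \<Rightarrow> 'y \<Rightarrow> 'y) \<Rightarrow>
     ('x::real_normed_vector \<Rightarrow> 'y::real_normed_vector) \<Rightarrow> 'x set \<Rightarrow> bool" where
  "holomorphic_map_on s1 s2 f S \<longleftrightarrow> (\<forall>x\<in>S. \<exists>D. complex_derivative s1 s2 f D x)"

type_synonym ('p, 'd) chart = "'p set \<times> ('p \<Rightarrow> complex^'d)"

definition complex_atlas :: "'p topology \<Rightarrow> ('p, 'd::finite) chart set \<Rightarrow> bool" where
  "complex_atlas X A \<longleftrightarrow>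
     (\<Union>(W, \<phi>)\<in>A. W) = topspace X \<and>
     (\<forall>(W, \<phi>)\<in>A. openin X W \<and> open (\<phi> ` W) \<and>
        homeomorphic_map (subtopology X W) (top_of_set (\<phi> ` W)) \<phi>) \<and>
     (\<forall>(W, \<phi>)\<in>A. \<forall>(W', \<phi>')\<in>A.
        holomorphic_map_on (*s) (*s) (\<phi>' \<circ> inv_into W \<phi>) (\<phi> ` (W \<inter> W')))"

definition complex_manifold :: "'p topology \<Rightarrow> ('p, 'd::finite) chart set \<Rightarrow> bool" where
  "complex_manifold X A \<longleftrightarrow> Hausdorff_space X \<and> second_countable X \<and> complex_atlas X A"

definition holomorphic_submersion ::
    "(complex^'m::finite) set \<Rightarrow> 'p topology \<Rightarrow> ('p, 'd::finite) chart set \<Rightarrow>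
     (complex^'m \<Rightarrow> 'p) \<Rightarrow> bool" where
  "holomorphic_submersion U X A q \<longleftrightarrow>
     continuous_map (top_of_set U) X q \<and>
     (\<forall>(W, \<phi>)\<in>A. \<forall>z\<in>U. q z \<in> W \<longrightarrow>
        (\<exists>D. complex_derivative (*s) (*s) (\<phi> \<circ> q) D z \<and> surj D))"

definition transported_charts ::
    "'q topology \<Rightarrow> ('q \<Rightarrow> 'p) \<Rightarrow> ('p, 'd) chart set \<Rightarrow> ('q, 'd::finite) chart set" where
  "transported_charts Y h A = (\<lambda>(W, \<phi>). ({y \<in> topspace Y. h y \<in> W}, \<phi> \<circ> h)) ` A"

section \<open>Quotients by coordinatewise multiplication\<close>

text \<open>The product on \<open>complex^'m\<close> is coordinatewise.\<close>

definition mult_orbit :: "(complex^'m::finite) set \<Rightarrow> complex^'m \<Rightarrow> (complex^'m) set" where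
  "mult_orbit G z = (\<lambda>g. g * z) ` G"

definition orbit_space ::
    "(complex^'m::finite) set \<Rightarrow> (complex^'m) set \<Rightarrow> (complex^'m) set topology" where
  "orbit_space G U = topology (\<lambda>V. V \<subseteq> mult_orbit G ` U \<and>
     openin (top_of_set U) {z \<in> U. mult_orbit G z \<in> V})"

lemma istopology_orbit_space:
  "istopology (\<lambda>V. V \<subseteq> mult_orbit G ` U \<and> openin (top_of_set U) {z \<in> U. mult_orbit G z \<in> V})"
proof -
  have eq1: "{z \<in> U. mult_orbit G z \<in> S \<inter> T} =
      {z \<in> U. mult_orbit G z \<in> S} \<inter> {z \<in> U. mult_orbit G z \<in> T}" for S T
    by auto
  have eq2: "{z \<in> U. mult_orbit G z \<in> \<Union>\<K>} = (\<Union>S\<in>\<K>. {z \<in> U. mult_orbit G z \<in> S})" for \<K>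
    by auto
  show ?thesis
    unfolding istopology_def eq1 eq2 by blast
qed

lemma openin_orbit_space:
  "openin (orbit_space G U) V \<longleftrightarrow>
     V \<subseteq> mult_orbit G ` U \<and> openin (top_of_set U) {z \<in> U. mult_orbit G z \<in> V}"
  unfolding orbit_space_def by (simp add: topology_inverse' istopology_orbit_space)

text \<open>The group is the image of the vector group \<open>complex^'l\<close> under \<open>e\<close>, which is also
  its holomorphic parametrization.\<close>

definition free_proper_holomorphic_action ::
    "(complex^'l::finite \<Rightarrow> complex^'m::finite) \<Rightarrow> (complex^'m) set \<Rightarrow> bool" where
  "free_proper_holomorphic_action e U \<longleftrightarrow>
     open U \<and>
     inj e \<and> e 0 = 1 \<and> (\<forall>v w. e (v + w) = e v * e w) \<and>
     (\<forall>g\<in>range e. \<forall>z\<in>U. g * z \<in> U) \<and>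
     (\<forall>g\<in>range e. \<forall>z\<in>U. g * z = z \<longrightarrow> g = 1) \<and>
     proper_map (prod_topology (top_of_set (range e)) (top_of_set U))
       (prod_topology (top_of_set U) (top_of_set U)) (\<lambda>(g, z). (g * z, z)) \<and>
     holomorphic_map_on (module_prod.scale (*s) (*s)) (*s) (\<lambda>(w, z). e w * z) (UNIV \<times> U)"

text \<open>\<open>Q\<close> is the complex structure of the quotient, determined up to equivalence of atlases by
  the projection being a holomorphic submersion; it is carried to \<open>Y\<close> along \<open>h\<close>.\<close>

definition complex_structure_as_quotient ::
    "'q topology \<Rightarrow> (complex^'m::finite) set \<Rightarrow> (complex^'l::finite \<Rightarrow> complex^'m) \<Rightarrow>
     ((complex^'m) set, 'd::finite) chart set \<Rightarrow> ('q \<Rightarrow> (complex^'m) set) \<Rightarrow> bool" where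
  "complex_structure_as_quotient Y U e Q h \<longleftrightarrow>
     free_proper_holomorphic_action e U \<and>
     complex_manifold (orbit_space (range e) U) Q \<and>
     holomorphic_submersion U (orbit_space (range e) U) Q (mult_orbit (range e)) \<and>
     homeomorphic_map Y (orbit_space (range e) U) h \<and>
     complex_manifold Y (transported_charts Y h Q)"

end

theory Submission
  imports Defs
begin

text \<open>
  Write \<open>U\<close> for the complement of the coordinate arrangement, \<open>Z\<close> for the moment-angle manifold
  and \<open>N\<close> for the kernel of the fan map in \<open>real^'m\<close>.  By a dimension count the real part of an
  admissible \<open>\<Psi>\<close> identifies \<open>complex^'l\<close> with \<open>N\<close>, and acting with \<open>e w = exp (\<Psi> w)\<close> multiplies
  \<open>\<bar>z\<^sub>i\<bar>\<^sup>2\<close> by \<open>exp (2 y\<^sub>i)\<close>, where \<open>y\<close> is the real part of \<open>\<Psi> w\<close>.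

  The topology rests on one fact: every orbit in \<open>U\<close> meets \<open>Z\<close> exactly once, and the group
  parameter that leads there depends continuously on the point.  Finding this parameter means
  rescaling a nonnegative vector \<open>r\<close> by \<open>exp y\<close>, \<open>y \<in> N\<close>, to the vector of slacks of a point of \<open>P\<close>.
  At a ghost \<open>y\<close> is unconstrained and the equation can be solved directly.  In the essential coordinates
  \<open>N\<close> is the orthogonal complement of the differences of slack vectors, so there the solutions are the
  critical points of the convex function \<open>\<Sum>i. r\<^sub>i exp y\<^sub>i - b\<^sub>i y\<^sub>i\<close>.
  Its minimum exists (\<open>N_scaling_exists\<close>), it is unique (\<open>N_scaling_unique\<close>) and it stays bounded
  while \<open>r\<close> varies near a given vector (\<open>N_scaling_locally_bounded\<close>).  All three use that the normals active at a point of \<open>P\<close>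
  are linearly independent, which genericity gives at the vertices.  Hence \<open>U\<close> is equivariantly
  \<open>complex^'l \<times> Z\<close>.  So the action is free and proper, \<open>Z\<close> maps homeomorphically onto the orbit space,
  and the orbit space is Hausdorff and second countable.

  For the complex structure, let \<open>J\<close> be the set of inequalities active at a vertex of \<open>P\<close>.
  Outside \<open>J\<close> there are \<open>2 * CARD('l)\<close> coordinates, and where these do not vanish their logarithms turn the action into translation by a complex
  subspace of dimension \<open>CARD('l)\<close>.  A complex linear complement of this subspace, together with the
  coordinates in \<open>J\<close> corrected by the group element used, gives holomorphic invariant coordinates with an
  explicit holomorphic transversal (\<open>invariant_chart_coords\<close>).  Coordinate changes are composites of a
  transversal with invariant coordinates, hence holomorphic (\<open>complex_atlas_quotient\<close>).

  If \<open>m + n\<close> is odd, the additional inequality \<open>1 \<ge> 0\<close> adds a coordinate of modulus \<open>1\<close> to \<open>Z\<close>, and the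
  even case applies.
\<close>

section \<open>Holomorphic maps between coordinate spaces\<close>

lemma has_derivative_vec:
  fixes f :: "'a::real_normed_vector \<Rightarrow> complex^'m::finite"
  assumes "\<And>i. ((\<lambda>x. f x $ i) has_derivative (\<lambda>h. D h $ i)) (at x)"
  shows "(f has_derivative D) (at x)"
proof -
  have "((\<lambda>x. f x \<bullet> k) has_derivative (\<lambda>h. D h \<bullet> k)) (at x)" if "k \<in> Basis" for k
  proof -
    obtain i b where k: "k = axis i b"
      using \<open>k \<in> Basis\<close> by (auto simp: Basis_vec_def)
    show ?thesis
      unfolding k inner_axis by (rule has_derivative_inner_left[OF assms])
  qed
  then show ?thesis
    by (subst has_derivative_componentwise_within) auto
qed

lemma vec_linear_iff:
  "Vector_Spaces.linear (*s) (*s) f \<longleftrightarrow>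
     (\<forall>x y. f (x + y) = f x + f y) \<and> (\<forall>c x. f (c *s x) = c *s (f x))"
  for f :: "complex^'a::finite \<Rightarrow> complex^'b::finite"
  by (simp add: Vector_Spaces.linear_iff vec.vector_space_axioms)

lemma scaleR_as_scalar_mult: "r *\<^sub>R x = complex_of_real r *s x"
  for x :: "complex^'a::finite"
  by (simp add: vec_eq_iff scaleR_conv_of_real[where 'a=complex])

lemma vec_linear_imp_real_linear:
  fixes f :: "complex^'a::finite \<Rightarrow> complex^'b::finite"
  assumes "Vector_Spaces.linear (*s) (*s) f"
  shows "linear f"
  using assms by (auto simp: vec_linear_iff scaleR_as_scalar_mult intro!: linearI)

lemma vec_linear_imp_bounded_linear:
  fixes f :: "complex^'a::finite \<Rightarrow> complex^'b::finite"
  assumes "Vector_Spaces.linear (*s) (*s) f"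
  shows "bounded_linear f"
  using vec_linear_imp_real_linear[OF assms] linear_conv_bounded_linear by blast

lemma complex_derivative_compose:
  assumes "complex_derivative s1 s2 f D x" and "complex_derivative s2 s3 g D' (f x)"
  shows "complex_derivative s1 s3 (g \<circ> f) (D' \<circ> D) x"
  using assms unfolding complex_derivative_def
  by (auto intro: diff_chain_at Vector_Spaces.linear_compose)

lemma complex_derivative_transform:
  assumes "complex_derivative s1 s2 f D x" and "open S" "x \<in> S" "\<And>y. y \<in> S \<Longrightarrow> f y = g y"
  shows "complex_derivative s1 s2 g D x"
  using assms unfolding complex_derivative_def
  by (auto intro: has_derivative_transform_within_open)

lemma complex_derivative_imp_isCont:
  "complex_derivative s1 s2 f D x \<Longrightarrow> isCont f x"
  unfolding complex_derivative_def by (auto intro: has_derivative_continuous)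

lemma holomorphic_map_on_imp_continuous_on:
  "holomorphic_map_on s1 s2 f S \<Longrightarrow> continuous_on S f"
  unfolding holomorphic_map_on_def
  by (meson complex_derivative_imp_isCont continuous_at_imp_continuous_on)

lemma continuous_on_vec_mult:
  fixes f g :: "'a::topological_space \<Rightarrow> complex^'n::finite"
  assumes "continuous_on S f" "continuous_on S g"
  shows "continuous_on S (\<lambda>x. f x * g x)"
proof -
  have eq: "(\<lambda>x. f x * g x) = (\<lambda>x. \<chi> i. f x $ i * g x $ i)"
    by (simp add: fun_eq_iff vec_eq_iff)
  show ?thesis
    by (subst eq) (intro continuous_intros assms)
qed

section \<open>Actions of a complex vector group by coordinatewise multiplication\<close>

locale vector_group_action =
  fixes e :: "complex^'l::finite \<Rightarrow> complex^'m::finite" and U :: "(complex^'m) set"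
  assumes open_U: "open U"
    and e_0: "e 0 = 1"
    and e_add: "e (v + w) = e v * e w"
    and e_mult_in_U: "z \<in> U \<Longrightarrow> e w * z \<in> U"
begin

abbreviation q :: "complex^'m \<Rightarrow> (complex^'m) set" where
  "q \<equiv> mult_orbit (range e)"

abbreviation X :: "(complex^'m) set topology" where
  "X \<equiv> orbit_space (range e) U"

lemma e_minus_cancel [simp]: "e (- w) * (e w * z) = z" "e w * (e (- w) * z) = z"
proof -
  have "e (- w) * e w = 1" "e w * e (- w) = 1"
    by (simp_all add: e_0 flip: e_add)
  then show "e (- w) * (e w * z) = z" "e w * (e (- w) * z) = z"
    by (metis mult.assoc mult_1_left)+
qed

lemma in_q_iff: "u \<in> q z \<longleftrightarrow> (\<exists>w. u = e w * z)"
  by (auto simp: mult_orbit_def)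

lemma self_in_q: "z \<in> q z"
  unfolding in_q_iff using e_0 by (metis mult_1_left)

lemma q_eq_iff: "q z = q u \<longleftrightarrow> (\<exists>w. u = e w * z)"
proof
  assume "q z = q u"
  then have "u \<in> q z"
    using self_in_q by simp
  then show "\<exists>w. u = e w * z"
    by (simp add: in_q_iff)
next
  assume "\<exists>w. u = e w * z"
  then obtain w where u: "u = e w * z" ..
  have "q u \<subseteq> q z"
    by (auto simp: in_q_iff u mult.assoc[symmetric] e_add[symmetric])
  moreover have "q z \<subseteq> q u"
  proof
    fix y assume "y \<in> q z"
    then obtain w' where "y = e w' * z"
      by (auto simp: in_q_iff)
    then have "y = e (w' + - w) * u"
      by (simp only: u e_add mult.assoc e_minus_cancel)
    then show "y \<in> q u"
      by (auto simp: in_q_iff)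
  qed
  ultimately show "q z = q u" by blast
qed

lemma q_e_mult [simp]: "q (e w * z) = q z"
  using q_eq_iff by metis

lemma openin_X_iff: "openin X V \<longleftrightarrow> V \<subseteq> q ` U \<and> open {z \<in> U. q z \<in> V}"
proof -
  have "{z \<in> U. q z \<in> V} \<subseteq> U" by auto
  then have "openin (top_of_set U) {z \<in> U. q z \<in> V} \<longleftrightarrow> open {z \<in> U. q z \<in> V}"
    by (simp add: openin_open_eq[OF open_U])
  then show ?thesis
    by (simp add: openin_orbit_space)
qed

lemma topspace_X: "topspace X = q ` U"
proof -
  have "{z \<in> U. q z \<in> q ` U} = U" by auto
  then have "openin X (q ` U)"
    unfolding openin_X_iff using open_U by simp
  moreover have "topspace X \<subseteq> q ` U"
    using openin_X_iff openin_topspace by blast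
  ultimately show ?thesis
    using openin_subset by blast
qed

lemma continuous_map_q: "continuous_map (top_of_set U) X q"
  unfolding continuous_map_def
  by (auto simp: topspace_X openin_orbit_space)

definition saturated :: "(complex^'m) set \<Rightarrow> bool" where
  "saturated O' \<longleftrightarrow> O' \<subseteq> U \<and> (\<forall>w. \<forall>z\<in>O'. e w * z \<in> O')"

lemma saturated_q_iff:
  assumes "saturated O'" "z \<in> U"
  shows "q z \<in> q ` O' \<longleftrightarrow> z \<in> O'"
proof
  assume "q z \<in> q ` O'"
  then obtain u where "u \<in> O'" "q u = q z" by auto
  then show "z \<in> O'"
    using assms(1) by (auto simp: saturated_def q_eq_iff)
qed auto

lemma openin_X_image:
  assumes "saturated O'" "open O'"
  shows "openin X (q ` O')"
proof -
  have "{z \<in> U. q z \<in> q ` O'} = O'"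
    using assms(1) saturated_q_iff by (auto simp: saturated_def)
  then show ?thesis
    using assms by (auto simp: openin_X_iff saturated_def)
qed

text \<open>A chart of the quotient, seen from upstairs: \<open>p\<close> is constant on orbits and reads off the
  coordinates, \<open>\<sigma>\<close> is a holomorphic transversal that meets each orbit in \<open>O'\<close>.  Working with the
  pair \<open>(p, \<sigma>)\<close> instead of a chart of the orbit space makes every coordinate change the composite
  \<open>p' \<circ> \<sigma>\<close> of holomorphic maps.\<close>

definition invariant_chart ::
    "(complex^'m) set \<Rightarrow> (complex^'m \<Rightarrow> complex^'d::finite) \<Rightarrow> (complex^'d) set \<Rightarrow>
     (complex^'d \<Rightarrow> complex^'m) \<Rightarrow> bool" where
  "invariant_chart O' p V \<sigma> \<longleftrightarrow>
     open O' \<and> saturated O' \<and> (\<forall>w. \<forall>z\<in>O'. p (e w * z) = p z) \<and>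
     holomorphic_map_on (*s) (*s) p O' \<and> p ` O' \<subseteq> V \<and>
     open V \<and> holomorphic_map_on (*s) (*s) \<sigma> V \<and> \<sigma> ` V \<subseteq> O' \<and>
     (\<forall>v\<in>V. p (\<sigma> v) = v) \<and> (\<forall>z\<in>O'. \<exists>w. \<sigma> (p z) = e w * z)"

lemma invariant_chart_meets_orbit:
  assumes "invariant_chart O' p V \<sigma>" "z \<in> O'"
  obtains w where "\<sigma> (p z) = e w * z"
  using assms unfolding invariant_chart_def by auto

text \<open>The map on the orbit space given by a function that is constant on orbits.\<close>

definition induced :: "(complex^'m \<Rightarrow> 'b) \<Rightarrow> (complex^'m) set \<Rightarrow> 'b" where
  "induced p o' = p (SOME z. z \<in> o')"

lemma representative_of_q:
  obtains w where "(SOME u. u \<in> q z) = e w * z"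
  using someI[of "\<lambda>u. u \<in> q z", OF self_in_q] by (auto simp: in_q_iff)

lemma induced_q:
  assumes "invariant_chart O' p V \<sigma>" "z \<in> O'"
  shows "induced p (q z) = p z"
  using assms representative_of_q[of z] by (metis induced_def invariant_chart_def)

lemma induced_image:
  assumes "invariant_chart O' p V \<sigma>"
  shows "induced p ` q ` O' = V"
proof -
  have "induced p ` q ` O' = p ` O'"
    using induced_q[OF assms] by (auto simp: image_image)
  also have "p ` O' = V"
    using assms unfolding invariant_chart_def by (metis image_eqI image_subset_iff subsetI subset_antisym)
  finally show ?thesis .
qed

lemma inj_on_induced:
  assumes "invariant_chart O' p V \<sigma>"
  shows "inj_on (induced p) (q ` O')"
proof (rule inj_onI)
  fix x y assume "x \<in> q ` O'" "y \<in> q ` O'" and eq: "induced p x = induced p y"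
  then obtain z u where z: "z \<in> O'" "x = q z" and u: "u \<in> O'" "y = q u" by auto
  obtain w w' where "\<sigma> (p z) = e w * z" "\<sigma> (p u) = e w' * u"
    using invariant_chart_meets_orbit[OF assms] z(1) u(1) by metis
  moreover have "p z = p u"
    using eq z u induced_q[OF assms] by simp
  ultimately have "q z = q u"
    by (metis q_e_mult)
  then show "x = y" using z u by simp
qed

lemma inv_into_induced:
  assumes "invariant_chart O' p V \<sigma>" "v \<in> V"
  shows "inv_into (q ` O') (induced p) v = q (\<sigma> v)"
proof (rule inv_into_f_eq[OF inj_on_induced[OF assms(1)]])
  show "q (\<sigma> v) \<in> q ` O'" "induced p (q (\<sigma> v)) = v"
    using assms induced_q[OF assms(1)] by (auto simp: invariant_chart_def image_subset_iff)
qed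

lemma homeomorphic_map_induced:
  assumes ch: "invariant_chart O' p V \<sigma>"
  shows "homeomorphic_map (subtopology X (q ` O')) (top_of_set V) (induced p)"
proof -
  have O': "open O'" "saturated O'" "O' \<subseteq> U" and V: "open V"
    and pO: "continuous_on O' p" and \<sigma>V: "continuous_on V \<sigma>" "\<sigma> ` V \<subseteq> O'"
    using ch holomorphic_map_on_imp_continuous_on unfolding invariant_chart_def saturated_def by auto
  have top: "topspace (subtopology X (q ` O')) = q ` O'"
    using O' by (auto simp: topspace_X)
  have "continuous_map (subtopology X (q ` O')) (top_of_set V) (induced p)"
    unfolding continuous_map_def top
  proof (intro conjI allI impI)
    show "induced p \<in> q ` O' \<rightarrow> topspace (top_of_set V)"
      using induced_image[OF ch] by auto
    fix S assume "openin (top_of_set V) S"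
    then have S: "open S" using V openin_open_trans by blast
    let ?B = "{x \<in> q ` O'. induced p x \<in> S}"
    have "z \<in> U \<and> q z \<in> ?B \<longleftrightarrow> z \<in> O' \<and> p z \<in> S" for z
    proof (cases "z \<in> O'")
      case True
      then show ?thesis
        using induced_q[OF ch] O'(3) by auto
    next
      case False
      then have "z \<in> U \<Longrightarrow> q z \<notin> q ` O'"
        using saturated_q_iff[OF O'(2)] by simp
      then show ?thesis
        using False by auto
    qed
    then have "{z \<in> U. q z \<in> ?B} = O' \<inter> p -` S" by blast
    moreover have "open (O' \<inter> p -` S)"
      using pO O'(1) S continuous_open_preimage by blast
    ultimately have "openin X ?B"
      using O'(3) by (auto simp: openin_X_iff)
    moreover have "?B = ?B \<inter> q ` O'" by auto
    ultimately show "openin (subtopology X (q ` O')) ?B"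
      unfolding openin_subtopology by (intro exI conjI)
  qed
  moreover have "continuous_map (top_of_set V) (subtopology X (q ` O')) (q \<circ> \<sigma>)"
  proof (rule continuous_map_into_subtopology)
    show "continuous_map (top_of_set V) X (q \<circ> \<sigma>)"
      using \<sigma>V O'(3) by (intro continuous_map_compose[OF _ continuous_map_q]) auto
    show "q \<circ> \<sigma> \<in> topspace (top_of_set V) \<rightarrow> q ` O'"
      using \<sigma>V by auto
  qed
  moreover have "(q \<circ> \<sigma>) (induced p x) = x" if x: "x \<in> q ` O'" for x
  proof -
    obtain z where z: "z \<in> O'" "x = q z"
      using x by auto
    then obtain w where "\<sigma> (p z) = e w * z"
      using invariant_chart_meets_orbit[OF ch] by metis
    then show ?thesis
      using z induced_q[OF ch] by simp
  qed
  moreover have "induced p ((q \<circ> \<sigma>) v) = v" if "v \<in> V" for v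
    using that ch induced_q[OF ch, of "\<sigma> v"] by (auto simp: invariant_chart_def image_subset_iff)
  ultimately have "homeomorphic_maps (subtopology X (q ` O')) (top_of_set V) (induced p) (q \<circ> \<sigma>)"
    unfolding homeomorphic_maps_def top by auto
  then show ?thesis
    using homeomorphic_map_maps by blast
qed

lemma transition_holomorphic:
  assumes ch: "invariant_chart O1 p1 V1 \<sigma>1" and ch': "invariant_chart O2 p2 V2 \<sigma>2"
  shows "holomorphic_map_on (*s) (*s) (induced p2 \<circ> inv_into (q ` O1) (induced p1))
           (induced p1 ` (q ` O1 \<inter> q ` O2))"
  unfolding holomorphic_map_on_def
proof
  fix v assume "v \<in> induced p1 ` (q ` O1 \<inter> q ` O2)"
  then obtain x where x: "x \<in> q ` O1" "x \<in> q ` O2" "v = induced p1 x" by auto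
  have v: "v \<in> V1"
    using x induced_image[OF ch] by auto
  have "q (\<sigma>1 v) = x"
    using inv_into_induced[OF ch v] x inj_on_induced[OF ch] by auto
  moreover have sat: "saturated O2" "open O2" "\<sigma>1 v \<in> U"
    using ch ch' v by (auto simp: invariant_chart_def saturated_def)
  ultimately have vO: "\<sigma>1 v \<in> O2"
    using x saturated_q_iff by blast
  have V1: "open V1" "continuous_on V1 \<sigma>1"
    using ch holomorphic_map_on_imp_continuous_on by (auto simp: invariant_chart_def)
  define N where "N = V1 \<inter> \<sigma>1 -` O2"
  have N: "open N" "v \<in> N"
    using continuous_open_preimage[OF V1(2,1) sat(2)] v vO by (auto simp: N_def)
  obtain D where D: "complex_derivative (*s) (*s) \<sigma>1 D v"
    using ch v by (auto simp: invariant_chart_def holomorphic_map_on_def)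
  obtain D' where D': "complex_derivative (*s) (*s) p2 D' (\<sigma>1 v)"
    using ch' vO by (auto simp: invariant_chart_def holomorphic_map_on_def)
  have "(p2 \<circ> \<sigma>1) u = (induced p2 \<circ> inv_into (q ` O1) (induced p1)) u" if "u \<in> N" for u
    using that inv_into_induced[OF ch] induced_q[OF ch'] by (auto simp: N_def)
  then show "\<exists>D. complex_derivative (*s) (*s) (induced p2 \<circ> inv_into (q ` O1) (induced p1)) D v"
    using complex_derivative_transform[OF complex_derivative_compose[OF D D'] N] by blast
qed

lemma invariant_chart_submersive:
  assumes ch: "invariant_chart O' p V \<sigma>" and z: "z \<in> O'"
  shows "\<exists>D. complex_derivative (*s) (*s) (induced p \<circ> q) D z \<and> surj D"
proof -
  have O': "open O'" "saturated O'"
    using ch by (auto simp: invariant_chart_def)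
  obtain D where D: "complex_derivative (*s) (*s) p D z"
    using ch z by (auto simp: invariant_chart_def holomorphic_map_on_def)
  obtain w where w: "\<sigma> (p z) = e w * z"
    using invariant_chart_meets_orbit[OF ch z] .
  have pz: "p z \<in> V" "open V"
    using ch z by (auto simp: invariant_chart_def)
  obtain D' where D': "(\<sigma> has_derivative D') (at (p z))"
    using ch pz by (auto simp: invariant_chart_def holomorphic_map_on_def complex_derivative_def)
  \<comment> \<open>The transversal through the point \<open>\<sigma> (p z)\<close> of the orbit, moved back to \<open>z\<close>, is a local
    section of \<open>p\<close> through \<open>z\<close>.\<close>
  have "((\<lambda>v. e (- w) * \<sigma> v) has_derivative (\<lambda>h. e (- w) * D' h)) (at (p z))"
    by (rule has_derivative_vec)
      (auto intro!: derivative_eq_intros bounded_linear.has_derivative[OF bounded_linear_vec_nth D'])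
  moreover have "(p has_derivative D) (at (e (- w) * \<sigma> (p z)))"
    using D w by (simp add: complex_derivative_def)
  ultimately have "((p \<circ> (\<lambda>v. e (- w) * \<sigma> v)) has_derivative (D \<circ> (\<lambda>h. e (- w) * D' h))) (at (p z))"
    by (rule diff_chain_at)
  moreover have "(p \<circ> (\<lambda>v. e (- w) * \<sigma> v)) v = v" if "v \<in> V" for v
    using ch that by (auto simp: invariant_chart_def image_subset_iff)
  ultimately have "((\<lambda>v. v) has_derivative (D \<circ> (\<lambda>h. e (- w) * D' h))) (at (p z))"
    by (rule has_derivative_transform_within_open[OF _ pz(2,1)])
  then have "D \<circ> (\<lambda>h. e (- w) * D' h) = (\<lambda>h. h)"
    by (rule has_derivative_unique[OF _ has_derivative_ident])
  then have "surj D"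
    by (metis comp_apply surjI)
  moreover have "complex_derivative (*s) (*s) (induced p \<circ> q) D z"
    using complex_derivative_transform[OF D O'(1) z] induced_q[OF ch] by simp
  ultimately show ?thesis by blast
qed

definition quotient_charts :: "((complex^'m) set, 'd::finite) chart set" where
  "quotient_charts = {(q ` O', induced p) | O' p. \<exists>V \<sigma>. invariant_chart O' p V \<sigma>}"

theorem complex_atlas_quotient:
  assumes cover: "\<And>z. z \<in> U \<Longrightarrow>
      \<exists>O' (p :: complex^'m \<Rightarrow> complex^'d::finite) V \<sigma>. invariant_chart O' p V \<sigma> \<and> z \<in> O'"
  shows "complex_atlas X (quotient_charts :: ((complex^'m) set, 'd) chart set)"
    and "holomorphic_submersion U X (quotient_charts :: ((complex^'m) set, 'd) chart set) q"
proof -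
  let ?Q = "quotient_charts :: ((complex^'m) set, 'd) chart set"
  have Q: "\<exists>O' p V \<sigma>. c = (q ` O', induced p) \<and> invariant_chart O' p V \<sigma>" if "c \<in> ?Q" for c
    using that unfolding quotient_charts_def by blast
  have "(\<Union>(W, \<phi>)\<in>?Q. W) = q ` U"
  proof
    show "(\<Union>(W, \<phi>)\<in>?Q. W) \<subseteq> q ` U"
      by (auto simp: quotient_charts_def invariant_chart_def saturated_def)
    show "q ` U \<subseteq> (\<Union>(W, \<phi>)\<in>?Q. W)"
    proof
      fix x assume "x \<in> q ` U"
      then obtain z where z: "z \<in> U" "x = q z" by auto
      obtain O' and p :: "complex^'m \<Rightarrow> complex^'d" and V \<sigma>
        where "invariant_chart O' p V \<sigma>" "z \<in> O'"
        using cover[OF z(1)] by blast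
      then have "(q ` O', induced p) \<in> ?Q" "x \<in> q ` O'"
        using z by (auto simp: quotient_charts_def)
      then show "x \<in> (\<Union>(W, \<phi>)\<in>?Q. W)" by blast
    qed
  qed
  moreover have "openin X (fst c) \<and> open (snd c ` fst c) \<and>
        homeomorphic_map (subtopology X (fst c)) (top_of_set (snd c ` fst c)) (snd c)"
    if W: "c \<in> ?Q" for c
  proof -
    obtain O' p V \<sigma> where c: "c = (q ` O', induced p)" and ch: "invariant_chart O' p V \<sigma>"
      using Q[OF W] by blast
    then have "open O'" "saturated O'" "open V"
      by (simp_all add: invariant_chart_def)
    then show ?thesis
      using homeomorphic_map_induced[OF ch] openin_X_image induced_image[OF ch] by (simp add: c)
  qed
  moreover have "holomorphic_map_on (*s) (*s) (snd c' \<circ> inv_into (fst c) (snd c))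
      (snd c ` (fst c \<inter> fst c'))"
    if W: "c \<in> ?Q" and W': "c' \<in> ?Q" for c c'
  proof -
    obtain O1 p1 V1 \<sigma>1 where c: "c = (q ` O1, induced p1)" and ch: "invariant_chart O1 p1 V1 \<sigma>1"
      using Q[OF W] by blast
    obtain O2 p2 V2 \<sigma>2 where c': "c' = (q ` O2, induced p2)" and ch': "invariant_chart O2 p2 V2 \<sigma>2"
      using Q[OF W'] by blast
    show ?thesis
      using transition_holomorphic[OF ch ch'] by (simp add: c c')
  qed
  ultimately show "complex_atlas X ?Q"
    unfolding complex_atlas_def topspace_X split_beta by (intro conjI ballI) simp_all
  have "\<exists>D. complex_derivative (*s) (*s) (snd c \<circ> q) D z \<and> surj D"
    if W: "c \<in> ?Q" "z \<in> U" "q z \<in> fst c" for c z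
  proof -
    obtain O' p V \<sigma> where c: "c = (q ` O', induced p)" and ch: "invariant_chart O' p V \<sigma>"
      using Q[OF W(1)] by blast
    have "saturated O'"
      using ch by (simp add: invariant_chart_def)
    then have "z \<in> O'"
      using W(2,3) saturated_q_iff[of O' z] by (simp add: c)
    then show ?thesis
      using invariant_chart_submersive[OF ch] by (simp add: c)
  qed
  then show "holomorphic_submersion U X ?Q q"
    unfolding holomorphic_submersion_def split_beta using continuous_map_q by (intro conjI ballI impI)
qed

end

section \<open>Actions with a global equivariant coordinate\<close>

lemma second_countable_euclidean: "second_countable (euclidean :: 'a::second_countable_topology topology)"
proof -
  obtain B :: "'a set set" where B: "countable B" "topological_basis B"
    using ex_countable_basis by auto
  then show ?thesis
    unfolding second_countable_def
    by (intro exI[of _ B] conjI ballI allI impI)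
      (auto simp: topological_basis_open elim: topological_basisE[OF B(2)])
qed

text \<open>An equivariant map \<open>\<omega>\<close> to the acting group trivializes the action: \<open>u\<close> is determined by
  \<open>\<omega> u\<close> and by the unique point of its orbit at which \<open>\<omega>\<close> vanishes.  Everything topological
  about the quotient is read off from this.\<close>

locale trivialized_action = vector_group_action e U
  for e :: "complex^'l::finite \<Rightarrow> complex^'m::finite" and U +
  fixes \<omega> :: "complex^'m \<Rightarrow> complex^'l"
  assumes continuous_e: "continuous_on UNIV e"
    and continuous_\<omega>: "continuous_on U \<omega>"
    and \<omega>_equivariant: "u \<in> U \<Longrightarrow> \<omega> (e v * u) = v + \<omega> u"
begin

definition slice :: "(complex^'m) set" where
  "slice = {u \<in> U. \<omega> u = 0}"

definition to_slice :: "complex^'m \<Rightarrow> complex^'m" where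
  "to_slice u = e (- \<omega> u) * u"

lemma slice_subset: "slice \<subseteq> U"
  by (auto simp: slice_def)

lemma to_slice_in_slice: "u \<in> U \<Longrightarrow> to_slice u \<in> slice"
  by (simp add: slice_def to_slice_def e_mult_in_U \<omega>_equivariant)

lemma to_slice_slice: "u \<in> slice \<Longrightarrow> to_slice u = u"
  by (simp add: slice_def to_slice_def e_0)

lemma to_slice_e_mult: "u \<in> U \<Longrightarrow> to_slice (e v * u) = to_slice u"
  by (simp add: to_slice_def \<omega>_equivariant mult.assoc[symmetric] e_add[symmetric])

lemma q_to_slice: "q (to_slice u) = q u"
  by (simp add: to_slice_def)

lemma continuous_to_slice: "continuous_on U to_slice"
  unfolding to_slice_def
  by (intro continuous_on_vec_mult continuous_on_compose2[OF continuous_e] continuous_on_minus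
      continuous_\<omega> continuous_on_id) auto

lemma homeomorphic_map_slice: "homeomorphic_map (top_of_set slice) X q"
proof -
  have cont: "continuous_map (top_of_set slice) X q"
    using continuous_map_from_subtopology_mono[OF continuous_map_q slice_subset] .
  have ind: "induced to_slice (q u) = to_slice u" if "u \<in> U" for u
    using representative_of_q[of u] to_slice_e_mult[OF that] by (metis induced_def)
  have "continuous_map X (top_of_set slice) (induced to_slice)"
    unfolding continuous_map_def topspace_X
  proof (intro conjI allI impI)
    show "induced to_slice \<in> q ` U \<rightarrow> topspace (top_of_set slice)"
      using ind to_slice_in_slice by auto
    fix S assume "openin (top_of_set slice) S"
    then have "openin (top_of_set U) (U \<inter> to_slice -` S)"
      using continuous_to_slice to_slice_in_slice by (intro continuous_openin_preimage) auto
    moreover have "{z \<in> U. q z \<in> {x \<in> q ` U. induced to_slice x \<in> S}} = U \<inter> to_slice -` S"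
      using ind by auto
    ultimately show "openin X {x \<in> q ` U. induced to_slice x \<in> S}"
      unfolding openin_orbit_space by auto
  qed
  moreover have "induced to_slice (q u) = u" if "u \<in> slice" for u
    using that ind to_slice_slice slice_subset by auto
  moreover have "q (induced to_slice x) = x" if "x \<in> q ` U" for x
    using that ind q_to_slice by auto
  ultimately have "homeomorphic_maps (top_of_set slice) X q (induced to_slice)"
    unfolding homeomorphic_maps_def topspace_X using cont by simp
  then show ?thesis
    using homeomorphic_map_maps by blast
qed

lemma Hausdorff_X: "Hausdorff_space X"
  using homeomorphic_Hausdorff_space[OF homeomorphic_map_imp_homeomorphic_space[OF homeomorphic_map_slice]]
  by (simp add: Hausdorff_space_subtopology)

lemma second_countable_X: "second_countable X"
  by (rule homeomorphic_space_second_countability[OF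
        homeomorphic_map_imp_homeomorphic_space[OF homeomorphic_map_slice], THEN iffD1,
        OF second_countable_subtopology[OF second_countable_euclidean]])

lemma action_free:
  assumes "u \<in> U" "e v * u = e w * u"
  shows "v = w"
proof -
  have "v + \<omega> u = w + \<omega> u"
    using \<omega>_equivariant[OF assms(1)] arg_cong[OF assms(2), of \<omega>] by simp
  then show ?thesis by simp
qed

text \<open>The action map embeds \<open>range e \<times> U\<close> onto the closed set of pairs lying in one orbit,
  that is, with the same projection to the slice; there \<open>\<omega>\<close> recovers the group element.\<close>

lemma action_proper:
  "proper_map (prod_topology (top_of_set (range e)) (top_of_set U))
     (prod_topology (top_of_set U) (top_of_set U)) (\<lambda>(g, z). (g * z, z))"
proof -
  let ?f = "\<lambda>(g, z). (g * z, z)"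
  define C where "C = {y \<in> U \<times> U. to_slice (fst y) = to_slice (snd y)}"
  define k where "k = (\<lambda>y. (e (\<omega> (fst y) - \<omega> (snd y)), snd y))"
  have "continuous_on (U \<times> U) (\<lambda>y. to_slice (fst y) - to_slice (snd y))"
    by (intro continuous_intros continuous_on_compose2[OF continuous_to_slice]) auto
  then have "closedin (top_of_set (U \<times> U)) {y \<in> U \<times> U. to_slice (fst y) - to_slice (snd y) = 0}"
    by (rule continuous_closedin_preimage_constant)
  then have closed_C: "closedin (top_of_set (U \<times> U)) C"
    by (simp add: C_def)
  have "continuous_on C k"
    unfolding k_def C_def
    by (intro continuous_intros continuous_on_compose2[OF continuous_e]
        continuous_on_compose2[OF continuous_\<omega>]) auto
  moreover have "k \<in> C \<rightarrow> range e \<times> U"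
    by (auto simp: k_def C_def)
  ultimately have pre: "closedin (top_of_set C) (C \<inter> k -` S)"
    if "closedin (top_of_set (range e \<times> U)) S" for S
    using that by (intro continuous_closedin_preimage_gen)
  have "inj_on ?f (range e \<times> U)"
    using action_free by (auto simp: inj_on_def)
  moreover have "closed_map (top_of_set (range e \<times> U)) (top_of_set (U \<times> U)) ?f"
    unfolding closed_map_def
  proof (intro allI impI)
    fix S assume S: "closedin (top_of_set (range e \<times> U)) S"
    have "?f ` S = C \<inter> k -` S"
    proof
      show "?f ` S \<subseteq> C \<inter> k -` S"
      proof
        fix y assume "y \<in> ?f ` S"
        moreover have "S \<subseteq> range e \<times> U"
          using S closedin_subset by fastforce
        ultimately obtain w z where "y = (e w * z, z)" "(e w, z) \<in> S" "z \<in> U"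
          by auto
        then show "y \<in> C \<inter> k -` S"
          by (simp add: C_def k_def e_mult_in_U to_slice_e_mult \<omega>_equivariant)
      qed
      show "C \<inter> k -` S \<subseteq> ?f ` S"
      proof
        fix y assume "y \<in> C \<inter> k -` S"
        then have y: "e (- \<omega> (fst y)) * fst y = e (- \<omega> (snd y)) * snd y" "k y \<in> S"
          by (auto simp: C_def to_slice_def)
        have "fst y = e (\<omega> (fst y)) * (e (- \<omega> (snd y)) * snd y)"
          unfolding y(1)[symmetric] by simp
        also have "\<dots> = e (\<omega> (fst y) - \<omega> (snd y)) * snd y"
          by (simp add: mult.assoc[symmetric] e_add[symmetric])
        finally have "?f (k y) = y"
          by (simp add: k_def prod_eq_iff)
        then show "y \<in> ?f ` S"
          using y(2) by (intro image_eqI) simp_all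
      qed
    qed
    then show "closedin (top_of_set (U \<times> U)) (?f ` S)"
      using closedin_trans[OF pre[OF S] closed_C] by simp
  qed
  ultimately have "proper_map (top_of_set (range e \<times> U)) (top_of_set (U \<times> U)) ?f"
    by (intro closed_injective_imp_proper_map) auto
  then show ?thesis
    by (simp add: subtopology_Times[symmetric] euclidean_product_topology)
qed

end

section \<open>Transport of charts\<close>

lemma complex_manifold_transported:
  assumes h: "homeomorphic_map Y X h" and A: "complex_manifold X A"
  shows "complex_manifold Y (transported_charts Y h A)"
proof -
  have hom: "Y homeomorphic_space X"
    using h homeomorphic_map_imp_homeomorphic_space by blast
  have "Hausdorff_space Y" "second_countable Y"
    using A homeomorphic_Hausdorff_space[OF hom] homeomorphic_space_second_countability[OF hom]
    by (simp_all add: complex_manifold_def)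
  have inj: "inj_on h (topspace Y)" and img: "h ` topspace Y = topspace X" and cont: "continuous_map Y X h"
    using h by (auto simp: homeomorphic_eq_everything_map)
  have cov: "(\<Union>c\<in>A. fst c) = topspace X"
    and chart: "\<And>c. c \<in> A \<Longrightarrow> openin X (fst c) \<and> open (snd c ` fst c) \<and>
        homeomorphic_map (subtopology X (fst c)) (top_of_set (snd c ` fst c)) (snd c)"
    and trans: "\<And>c c'. c \<in> A \<Longrightarrow> c' \<in> A \<Longrightarrow>
        holomorphic_map_on (*s) (*s) (snd c' \<circ> inv_into (fst c) (snd c)) (snd c ` (fst c \<inter> fst c'))"
    using A unfolding complex_manifold_def complex_atlas_def split_beta by simp_all
  define B where "B = (\<lambda>W. {y \<in> topspace Y. h y \<in> W})"
  have T: "transported_charts Y h A = (\<lambda>c. (B (fst c), snd c \<circ> h)) ` A"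
    by (simp add: transported_charts_def B_def split_beta)
  have sub: "fst c \<subseteq> topspace X" if "c \<in> A" for c
    using chart[OF that] openin_subset by blast
  have hB: "h ` B W = W" if "W \<subseteq> topspace X" for W
    using that unfolding B_def img[symmetric] by blast
  have hBI: "h ` (B W \<inter> B W') = W \<inter> W'" if "W \<subseteq> topspace X" for W W'
    using that unfolding B_def img[symmetric] by blast
  have "h y \<in> (\<Union>c\<in>A. fst c)" if "y \<in> topspace Y" for y
    unfolding cov img[symmetric] using that by (rule imageI)
  then have "(\<Union>c\<in>transported_charts Y h A. fst c) = topspace Y"
    unfolding T B_def by (auto simp: image_image)
  moreover have "openin Y (fst c) \<and> open (snd c ` fst c) \<and>
        homeomorphic_map (subtopology Y (fst c)) (top_of_set (snd c ` fst c)) (snd c)"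
    if "c \<in> transported_charts Y h A" for c
  proof -
    obtain c0 where c0: "c0 \<in> A" "c = (B (fst c0), snd c0 \<circ> h)"
      using \<open>c \<in> _\<close> unfolding T by blast
    have "openin Y (B (fst c0))"
      using cont chart[OF c0(1)] unfolding B_def continuous_map_def by blast
    moreover have im: "(snd c0 \<circ> h) ` B (fst c0) = snd c0 ` fst c0"
      by (simp only: image_comp[symmetric] hB[OF sub[OF c0(1)]])
    moreover have "homeomorphic_map (subtopology Y (B (fst c0))) (subtopology X (fst c0)) h"
      using homeomorphic_map_subtopologies[OF h, of "B (fst c0)" "fst c0"] sub[OF c0(1)] hB
      by (auto simp: B_def inf.absorb2)
    then have "homeomorphic_map (subtopology Y (B (fst c0))) (top_of_set (snd c0 ` fst c0)) (snd c0 \<circ> h)"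
      using chart[OF c0(1)] homeomorphic_map_compose by blast
    ultimately show ?thesis
      using chart[OF c0(1)] by (simp add: c0(2) im)
  qed
  moreover have "holomorphic_map_on (*s) (*s) (snd c' \<circ> inv_into (fst c) (snd c))
      (snd c ` (fst c \<inter> fst c'))"
    if "c \<in> transported_charts Y h A" "c' \<in> transported_charts Y h A" for c c'
  proof -
    obtain c0 where c0: "c0 \<in> A" "c = (B (fst c0), snd c0 \<circ> h)"
      using \<open>c \<in> _\<close> unfolding T by blast
    obtain c1 where c1: "c1 \<in> A" "c' = (B (fst c1), snd c1 \<circ> h)"
      using \<open>c' \<in> _\<close> unfolding T by blast
    have injc: "inj_on (snd c0) (fst c0)"
      using chart[OF c0(1)] sub[OF c0(1)]
      by (auto simp: homeomorphic_eq_everything_map inf.absorb2)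
    have inj2: "inj_on (snd c0 \<circ> h) (B (fst c0))"
      using inj injc by (intro comp_inj_on) (auto simp: B_def inj_on_def)
    have eq: "snd c1 (inv_into (fst c0) (snd c0) v) = ((snd c1 \<circ> h) \<circ> inv_into (B (fst c0)) (snd c0 \<circ> h)) v"
      if "v \<in> snd c0 ` fst c0" for v
    proof -
      have "v \<in> (snd c0 \<circ> h) ` B (fst c0)"
        using that by (simp only: image_comp[symmetric] hB[OF sub[OF c0(1)]])
      then obtain y where y: "y \<in> B (fst c0)" "v = snd c0 (h y)" by auto
      then have "inv_into (B (fst c0)) (snd c0 \<circ> h) v = y"
        using inv_into_f_f[OF inj2 y(1)] by simp
      moreover have "inv_into (fst c0) (snd c0) v = h y"
        using inv_into_f_f[OF injc, of "h y"] y by (simp add: B_def)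
      ultimately show ?thesis by simp
    qed
    have "openin (top_of_set (snd c0 ` fst c0)) (snd c0 ` (fst c0 \<inter> fst c1))"
    proof -
      have "openin (subtopology X (fst c0)) (fst c0 \<inter> fst c1)"
        using chart[OF c0(1)] chart[OF c1(1)] by (simp add: openin_subtopology_Int2)
      then show ?thesis
        using chart[OF c0(1)] unfolding homeomorphic_eq_everything_map open_map_def by blast
    qed
    then have opn: "open (snd c0 ` (fst c0 \<inter> fst c1))"
      using chart[OF c0(1)] openin_open_trans by blast
    have S: "snd c ` (fst c \<inter> fst c') = snd c0 ` (fst c0 \<inter> fst c1)"
      by (simp only: c0(2) c1(2) fst_conv snd_conv image_comp[symmetric] hBI[OF sub[OF c0(1)]])
    show ?thesis
      unfolding S holomorphic_map_on_def
    proof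
      fix v assume v: "v \<in> snd c0 ` (fst c0 \<inter> fst c1)"
      obtain D where D: "complex_derivative (*s) (*s) (snd c1 \<circ> inv_into (fst c0) (snd c0)) D v"
        using trans[OF c0(1) c1(1)] v unfolding holomorphic_map_on_def by blast
      have "(snd c1 \<circ> inv_into (fst c0) (snd c0)) u = (snd c' \<circ> inv_into (fst c) (snd c)) u"
        if "u \<in> snd c0 ` (fst c0 \<inter> fst c1)" for u
      proof -
        have "u \<in> snd c0 ` fst c0"
          using that by blast
        then show ?thesis
          using eq[of u] by (simp add: c0(2) c1(2))
      qed
      then show "\<exists>D. complex_derivative (*s) (*s) (snd c' \<circ> inv_into (fst c) (snd c)) D v"
        using complex_derivative_transform[OF D opn v] by blast
    qed
  qed
  ultimately have "complex_atlas Y (transported_charts Y h A)"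
    unfolding complex_atlas_def split_beta by (intro conjI ballI) simp_all
  then show ?thesis
    using \<open>Hausdorff_space Y\<close> \<open>second_countable Y\<close> by (simp add: complex_manifold_def)
qed

section \<open>Combinatorics of a generic presentation\<close>

lemma in_open_segment_symmetric:
  fixes x d :: "'a::real_vector"
  assumes "d \<noteq> 0"
  shows "x \<in> open_segment (x - d) (x + d)"
proof -
  have "x - d \<noteq> x + d"
  proof
    assume eq: "x - d = x + d"
    have "2 *\<^sub>R d = (x + d) - (x - d)"
      by (simp add: scaleR_2)
    also have "\<dots> = 0"
      by (simp only: eq diff_self)
    finally show False
      using assms by simp
  qed
  moreover have "x = (1 - 1 / 2) *\<^sub>R (x - d) + (1 / 2) *\<^sub>R (x + d)"
    by (simp add: scaleR_add_right[symmetric] scaleR_2[symmetric])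
  ultimately show ?thesis
    unfolding in_segment by (intro conjI exI[of _ "1 / 2 :: real"]) auto
qed

locale generic_polytope =
  fixes E :: "'v::euclidean_space set" and a :: "'m::finite \<Rightarrow> 'v" and b :: "'m \<Rightarrow> real"
  assumes subspace_E: "subspace E"
    and normal_in_E: "a i \<in> E"
    and compact_P: "compact (presented_polytope E a b)"
    and P_nonempty: "presented_polytope E a b \<noteq> {}"
    and generic: "generic_presentation E a b"
begin

abbreviation P :: "'v set" where "P \<equiv> presented_polytope E a b"
abbreviation K :: "'m set set" where "K \<equiv> polytope_complex E a b"
abbreviation g :: "'m \<Rightarrow> 'v" where "g \<equiv> fan_generator E a b"

definition slack :: "'v \<Rightarrow> 'm \<Rightarrow> real" where "slack x i = a i \<bullet> x + b i"

lemma P_iff: "x \<in> P \<longleftrightarrow> x \<in> E \<and> (\<forall>i. slack x i \<ge> 0)"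
  by (simp add: presented_polytope_def slack_def)

lemma slack_nonneg: "x \<in> P \<Longrightarrow> slack x i \<ge> 0"
  by (simp add: P_iff)

lemma slack_diff: "slack x i - slack y i = a i \<bullet> (x - y)"
  by (simp add: slack_def inner_diff_right)

lemma continuous_slack: "continuous_on S (\<lambda>x. slack x i)"
  unfolding slack_def by (intro continuous_intros)

lemma K_iff: "I \<in> K \<longleftrightarrow> (\<exists>x\<in>P. \<forall>i\<in>I. slack x i = 0)"
proof -
  have face: "pres_face E a b i = {x \<in> P. slack x i = 0}" for i
    by (auto simp: pres_face_def pres_hyperplane_def P_iff slack_def)
  show ?thesis
  proof (cases "I = {}")
    case True
    then show ?thesis
      using P_nonempty by (auto simp: polytope_complex_def)
  next
    case False
    then show ?thesis
      unfolding polytope_complex_def face by blast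
  qed
qed

lemma K_subset: "J \<in> K \<Longrightarrow> I \<subseteq> J \<Longrightarrow> I \<in> K"
  by (meson K_iff subsetD)

lemma span_E: "span E = E"
  using subspace_E span_eq_iff by blast

text \<open>Every face contains a vertex, and at a vertex the active normals span: a direction
  orthogonal to all of them could be followed both ways inside the face.\<close>

lemma vertex_of_face:
  assumes x0: "x0 \<in> P"
  obtains x where "x \<in> P" "\<And>i. slack x0 i = 0 \<Longrightarrow> slack x i = 0"
    "span (a ` {i. slack x i = 0}) = E"
proof -
  define F where "F = {x \<in> P. \<forall>i. slack x0 i = 0 \<longrightarrow> slack x i = 0}"
  have F_eq: "F = P \<inter> (\<Inter>i\<in>{i. slack x0 i = 0}. {x. a i \<bullet> x = - b i})"
    by (auto simp: F_def slack_def)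
  have "convex P"
  proof -
    have "slack x i \<ge> 0 \<longleftrightarrow> a i \<bullet> x \<ge> - b i" for x i
      by (auto simp: slack_def)
    then have "P = E \<inter> (\<Inter>i. {x. a i \<bullet> x \<ge> - b i})"
      by (simp add: set_eq_iff P_iff)
    then show ?thesis
      using subspace_imp_convex[OF subspace_E]
      by (auto intro!: convex_Int convex_INT convex_halfspace_ge)
  qed
  then have "convex F"
    unfolding F_eq by (intro convex_Int convex_INT convex_hyperplane)
  moreover have "compact F"
    unfolding F_eq by (intro compact_Int_closed compact_P closed_INT ballI closed_hyperplane)
  moreover have "F \<noteq> {}"
    using x0 by (auto simp: F_def)
  ultimately obtain x where x: "x extreme_point_of F"
    using extreme_point_exists_convex by blast
  then have xF: "x \<in> F" and ext: "\<And>y z. y \<in> F \<Longrightarrow> z \<in> F \<Longrightarrow> x \<notin> open_segment y z"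
    by (auto simp: extreme_point_of_def)
  let ?J = "{i. slack x i = 0}"
  have sub: "span (a ` ?J) \<subseteq> E"
    using normal_in_E subspace_E by (intro span_minimal) auto
  have "span (a ` ?J) = E"
  proof (rule ccontr)
    assume "span (a ` ?J) \<noteq> E"
    then have "span (a ` ?J) \<subset> span E"
      using sub by (simp add: span_E psubset_eq)
    then obtain v where v: "v \<noteq> 0" "v \<in> span E" "\<And>y. y \<in> span (a ` ?J) \<Longrightarrow> orthogonal v y"
      using orthogonal_to_subspace_exists_gen by metis
    have vE: "v \<in> E"
      using v(2) by (simp add: span_E)
    have v0: "a i \<bullet> v = 0" if "slack x i = 0" for i
      using v(3)[of "a i"] that span_base[of "a i" "a ` ?J"] by (auto simp: orthogonal_def inner_commute)
    define \<epsilon> where "\<epsilon> = Min (insert 1 ((\<lambda>i. slack x i / (\<bar>a i \<bullet> v\<bar> + 1)) ` {i. slack x i > 0}))"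
    have \<epsilon>: "\<epsilon> > 0"
      unfolding \<epsilon>_def by (subst Min_gr_iff) (auto intro!: divide_pos_pos)
    have xP: "x \<in> P"
      using xF by (simp add: F_def)
    have inF: "x + t *\<^sub>R v \<in> F" if t: "\<bar>t\<bar> \<le> \<epsilon>" for t
    proof -
      have "slack (x + t *\<^sub>R v) i \<ge> 0" for i
      proof (cases "slack x i = 0")
        case True
        then show ?thesis
          using v0[of i] by (simp add: slack_def inner_add_right)
      next
        case False
        then have pos: "slack x i > 0"
          using slack_nonneg[OF xP, of i] by simp
        then have "\<epsilon> \<le> slack x i / (\<bar>a i \<bullet> v\<bar> + 1)"
          unfolding \<epsilon>_def by (intro Min_le) auto
        then have "\<epsilon> * (\<bar>a i \<bullet> v\<bar> + 1) \<le> slack x i"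
          by (simp add: pos_le_divide_eq)
        moreover have "\<bar>t * (a i \<bullet> v)\<bar> \<le> \<epsilon> * (\<bar>a i \<bullet> v\<bar> + 1)"
          unfolding abs_mult using t \<epsilon> by (intro mult_mono) auto
        ultimately show ?thesis
          by (simp add: slack_def inner_add_right)
      qed
      moreover have "x + t *\<^sub>R v \<in> E"
        using xP vE subspace_E by (simp add: P_iff subspace_add subspace_scale)
      moreover have "slack (x + t *\<^sub>R v) i = 0" if "slack x0 i = 0" for i
      proof -
        have "slack x i = 0"
          using xF that by (simp add: F_def)
        then show ?thesis
          using v0[of i] by (simp add: slack_def inner_add_right)
      qed
      ultimately show ?thesis
        by (simp add: F_def P_iff)
    qed
    have "\<epsilon> *\<^sub>R v \<noteq> 0"
      using v(1) \<epsilon> by simp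
    from in_open_segment_symmetric[OF this, of x]
    have "x \<in> open_segment (x + (-\<epsilon>) *\<^sub>R v) (x + \<epsilon> *\<^sub>R v)"
      by simp
    then show False
      using ext[OF inF[of "-\<epsilon>"] inF[of "\<epsilon>"]] \<epsilon> by simp
  qed
  then show ?thesis
    using that xF unfolding F_def by blast
qed

text \<open>Spanning takes at least \<open>dim E\<close> normals and genericity allows at most that many.\<close>

lemma vertex_independent:
  assumes x: "x \<in> P" "span (a ` {i. slack x i = 0}) = E"
  shows "card {i. slack x i = 0} = dim E" "inj_on a {i. slack x i = 0}"
    "independent (a ` {i. slack x i = 0})"
proof -
  let ?J = "{i. slack x i = 0}"
  have "{i. x \<in> pres_hyperplane E a b i} = ?J"
    using x(1) by (auto simp: pres_hyperplane_def slack_def P_iff)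
  then have J: "card ?J \<le> dim E"
    using generic x(1) by (auto simp: generic_presentation_def)
  have "dim E \<le> card (a ` ?J)"
    using x(2) by (metis dim_le_card finite finite_imageI dim_span order_refl span_superset)
  moreover have "card (a ` ?J) \<le> card ?J"
    by (simp add: card_image_le)
  ultimately have eq: "card (a ` ?J) = card ?J" "card ?J = dim E"
    using J by linarith+
  show "card ?J = dim E" by fact
  show "inj_on a ?J"
    using eq(1) by (intro eq_card_imp_inj_on) auto
  show "independent (a ` ?J)"
    using eq x(2) normal_in_E by (intro card_le_dim_spanning[of _ E]) auto
qed

lemma extend_to_vertex:
  assumes "I \<in> K"
  obtains J where "I \<subseteq> J" "J \<in> K" "card J = dim E"
proof -
  obtain x0 where "x0 \<in> P" "\<forall>i\<in>I. slack x0 i = 0"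
    using assms K_iff by blast
  moreover obtain x where "x \<in> P" "\<And>i. slack x0 i = 0 \<Longrightarrow> slack x i = 0"
    "span (a ` {i. slack x i = 0}) = E"
    using vertex_of_face[OF \<open>x0 \<in> P\<close>] by metis
  ultimately show ?thesis
    using that[of "{i. slack x i = 0}"] vertex_independent(1)[of x] K_iff by auto
qed

text \<open>The normals active at a point are among those active at a vertex of the face containing it.\<close>

lemma active_normals_independent:
  assumes x0: "x0 \<in> P" and supp: "\<And>i. slack x0 i \<noteq> 0 \<Longrightarrow> y i = 0"
    and sum0: "(\<Sum>i\<in>UNIV. y i *\<^sub>R a i) = 0"
  shows "y i = 0"
proof -
  obtain x where x: "x \<in> P" "\<And>i. slack x0 i = 0 \<Longrightarrow> slack x i = 0"
    "span (a ` {i. slack x i = 0}) = E"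
    using vertex_of_face[OF x0] by metis
  let ?J = "{i. slack x i = 0}"
  note J = vertex_independent[OF x(1,3)]
  have "(\<Sum>v\<in>a ` ?J. y (inv_into ?J a v) *\<^sub>R v) = (\<Sum>i\<in>?J. y i *\<^sub>R a i)"
    using J(2) by (simp add: sum.reindex)
  also have "\<dots> = (\<Sum>i\<in>UNIV. y i *\<^sub>R a i)"
    using supp x(2) by (intro sum.mono_neutral_left) auto
  finally have z: "(\<Sum>v\<in>a ` ?J. y (inv_into ?J a v) *\<^sub>R v) = 0"
    using sum0 by simp
  show ?thesis
  proof (cases "i \<in> ?J")
    case True
    then show ?thesis
      using independentD[OF J(3) _ subset_refl z, of "a i"] J(2) by simp
  next
    case False
    then show ?thesis
      using supp x(2) by blast
  qed
qed

text \<open>The indices that are not ghosts.\<close>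

definition essential :: "'m \<Rightarrow> bool" where
  "essential i \<longleftrightarrow> {i} \<in> K"

lemma active_essential: "x \<in> P \<Longrightarrow> slack x i = 0 \<Longrightarrow> essential i"
  by (auto simp: essential_def K_iff)

lemma ghost_slack_pos: "x \<in> P \<Longrightarrow> \<not> essential i \<Longrightarrow> slack x i > 0"
  using slack_nonneg active_essential by (metis less_eq_real_def)

lemma g_eq: "g i = (if essential i then a i else 0)"
  by (simp add: fan_generator_def essential_def)

text \<open>\<open>P\<close> is open and closed in the polyhedron cut out by the essential inequalities, because
  the others are strict on \<open>P\<close>.\<close>

lemma in_P_if_essential:
  assumes "x \<in> E" "\<And>i. essential i \<Longrightarrow> slack x i \<ge> 0"
  shows "x \<in> P"
proof -
  define S where "S = E \<inter> (\<Inter>i\<in>{i. essential i}. {x. a i \<bullet> x \<ge> - b i})"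
  have S: "y \<in> S \<longleftrightarrow> y \<in> E \<and> (\<forall>i. essential i \<longrightarrow> slack y i \<ge> 0)" for y
    unfolding S_def slack_def by auto
  have "convex S"
    unfolding S_def by (intro convex_Int convex_INT convex_halfspace_ge subspace_imp_convex subspace_E)
  then have "connected S"
    by (rule convex_connected)
  moreover have "closedin (top_of_set S) P"
    using compact_P by (intro closed_subset) (auto simp: S P_iff intro: compact_imp_closed)
  moreover have "openin (top_of_set S) P"
  proof -
    have "open (\<Inter>i\<in>{i. \<not> essential i}. {y. slack y i > 0})"
      unfolding slack_def by (intro open_INT finite ballI open_Collect_less continuous_intros)
    moreover have "P = S \<inter> (\<Inter>i\<in>{i. \<not> essential i}. {y. slack y i > 0})"
    proof
      show "P \<subseteq> S \<inter> (\<Inter>i\<in>{i. \<not> essential i}. {y. slack y i > 0})"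
        using ghost_slack_pos by (auto simp: S P_iff)
      show "S \<inter> (\<Inter>i\<in>{i. \<not> essential i}. {y. slack y i > 0}) \<subseteq> P"
      proof
        fix y assume y: "y \<in> S \<inter> (\<Inter>i\<in>{i. \<not> essential i}. {y. slack y i > 0})"
        have "slack y i \<ge> 0" for i
          using y S by (cases "essential i") (auto intro: less_imp_le)
        then show "y \<in> P"
          using y S by (simp add: P_iff)
      qed
    qed
    ultimately show ?thesis
      using openin_open_Int by simp
  qed
  ultimately have "P = S"
    using P_nonempty unfolding connected_clopen by blast
  then show ?thesis
    using assms by (simp add: S)
qed

section \<open>The kernel of the fan map\<close>

definition N :: "(real^'m) set" where
  "N = {y. fan_map E a b y = 0}"

text \<open>The adjoint of the fan map.  In the essential coordinates it is the linear part of the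
  slack vector.\<close>

definition dual_map :: "'v \<Rightarrow> real^'m" where
  "dual_map x = (\<chi> i. g i \<bullet> x)"

lemma linear_dual_map: "linear dual_map"
  by (rule linearI) (simp_all add: dual_map_def vec_eq_iff inner_add_right)

lemma inner_dual_map: "y \<bullet> dual_map x = fan_map E a b y \<bullet> x"
  by (simp add: dual_map_def fan_map_def inner_vec_def inner_sum_left)

lemma g_in_E: "g i \<in> E"
  by (simp add: g_eq normal_in_E subspace_0 subspace_E)

lemma fan_map_in_E: "fan_map E a b y \<in> E"
  unfolding fan_map_def by (intro subspace_sum subspace_E subspace_scale g_in_E)

lemma dual_map_inj:
  assumes "x \<in> E" "dual_map x = 0"
  shows "x = 0"
proof -
  obtain x0 where "x0 \<in> P"
    using P_nonempty by blast
  then obtain z where z: "z \<in> P" "span (a ` {i. slack z i = 0}) = E"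
    using vertex_of_face by metis
  have "a i \<bullet> x = 0" if "slack z i = 0" for i
    using arg_cong[OF assms(2), of "\<lambda>v. v $ i"] active_essential[OF z(1) that]
    by (simp add: dual_map_def g_eq)
  then have "span (a ` {i. slack z i = 0}) \<subseteq> {v. v \<bullet> x = 0}"
    by (intro span_minimal subspace_hyperplane2) auto
  then show ?thesis
    using assms(1) z(2) by auto
qed

lemma N_eq_orthogonal: "N = {y. \<forall>x\<in>dual_map ` E. orthogonal x y}"
proof -
  have "y \<in> N \<longleftrightarrow> (\<forall>x\<in>E. fan_map E a b y \<bullet> x = 0)" for y
    using fan_map_in_E[of y] by (auto simp: N_def)
  then show ?thesis
    by (auto simp: orthogonal_def inner_commute[of "dual_map _"] inner_dual_map)
qed

lemma subspace_N: "subspace N"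
  using subspace_orthogonal_comp[of "dual_map ` E"] by (simp add: N_eq_orthogonal orthogonal_comp_def)

lemma dim_N: "dim N + dim E = CARD('m)"
proof -
  have "inj_on dual_map (span E)"
    using dual_map_inj linear_injective_on_subspace_0[OF linear_dual_map subspace_E]
    by (simp add: span_E)
  then have "dim (dual_map ` E) = dim E"
    by (rule dim_image_eq[OF linear_dual_map])
  moreover have "dim {y \<in> UNIV. \<forall>x\<in>dual_map ` E. orthogonal x y} + dim (dual_map ` E) = dim (UNIV :: (real^'m) set)"
    by (intro dim_subspace_orthogonal_to_vectors linear_subspace_image linear_dual_map subspace_E) auto
  ultimately show ?thesis
    by (simp add: N_eq_orthogonal)
qed

lemma orthogonal_to_N:
  assumes "\<And>y. y \<in> N \<Longrightarrow> y \<bullet> s = 0"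
  shows "\<exists>x\<in>E. s = dual_map x"
proof -
  have "N = (dual_map ` E)\<^sup>\<bottom>"
    by (simp add: N_eq_orthogonal orthogonal_comp_def)
  then have "N\<^sup>\<bottom> = dual_map ` E"
    using orthogonal_comp_self[OF linear_subspace_image[OF linear_dual_map subspace_E]] by simp
  moreover have "s \<in> N\<^sup>\<bottom>"
    using assms by (simp add: orthogonal_comp_def orthogonal_def)
  ultimately show ?thesis by auto
qed

text \<open>The coordinates of a kernel vector at the ghosts are arbitrary.\<close>

lemma N_cong:
  assumes "y \<in> N" "\<And>i. essential i \<Longrightarrow> y' $ i = y $ i"
  shows "y' \<in> N"
proof -
  have "fan_map E a b y' = fan_map E a b y"
    unfolding fan_map_def by (intro sum.cong) (auto simp: g_eq assms(2))
  then show ?thesis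
    using assms(1) by (simp add: N_def)
qed

lemma N_supported_zero:
  assumes y: "y \<in> N" and x: "x \<in> P" and supp: "\<And>i. slack x i \<noteq> 0 \<Longrightarrow> y $ i = 0"
  shows "y = 0"
proof -
  have "(\<Sum>i\<in>UNIV. (y $ i) *\<^sub>R a i) = (\<Sum>i\<in>UNIV. (y $ i) *\<^sub>R g i)"
    using supp active_essential[OF x] by (intro sum.cong) (auto simp: g_eq)
  then have sum0: "(\<Sum>i\<in>UNIV. (y $ i) *\<^sub>R a i) = 0"
    using y by (simp add: N_def fan_map_def)
  have "y $ i = 0" for i
    by (rule active_normals_independent[OF x, where y = "\<lambda>i. y $ i", OF supp sum0])
  then show ?thesis
    by (simp add: vec_eq_iff)
qed

lemma N_supported_zero_K:
  assumes "y \<in> N" "J \<in> K" "\<And>i. i \<notin> J \<Longrightarrow> y $ i = 0"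
  shows "y = 0"
proof -
  obtain x where "x \<in> P" "\<forall>i\<in>J. slack x i = 0"
    using assms(2) K_iff by blast
  then show ?thesis
    using N_supported_zero[OF assms(1)] assms(3) by metis
qed

text \<open>In the essential coordinates slack vectors differ by a vector in the range of the adjoint
  of the fan map.\<close>

lemma N_orthogonal_slack:
  assumes "y \<in> N"
  shows "(\<Sum>i | essential i. y $ i * (slack x i - slack x' i)) = 0"
proof -
  have "(\<Sum>i | essential i. y $ i * (slack x i - slack x' i)) = (\<Sum>i\<in>UNIV. y $ i * (g i \<bullet> (x - x')))"
    by (intro sum.mono_neutral_cong_left) (auto simp: slack_diff g_eq)
  also have "\<dots> = fan_map E a b y \<bullet> (x - x')"
    by (simp add: fan_map_def inner_sum_left)
  finally show ?thesis
    using assms by (simp add: N_def)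
qed

text \<open>On \<open>N\<close> the coordinates at which \<open>x0\<close> has positive slack determine the others, by the
  independence of the active normals; so they also bound them.\<close>

lemma N_bound:
  assumes x0: "x0 \<in> P"
  obtains \<kappa> where "\<kappa> > 0" "\<And>y. y \<in> N \<Longrightarrow> norm y \<le> \<kappa> * (\<Sum>i\<in>UNIV. slack x0 i * \<bar>y $ i\<bar>)"
proof -
  define f where "f = (\<lambda>y::real^'m. (\<chi> i. slack x0 i * y $ i) :: real^'m)"
  have "linear f"
    by (rule linearI) (simp_all add: f_def vec_eq_iff distrib_left)
  moreover have "\<forall>y\<in>N. f y = 0 \<longrightarrow> y = 0"
    using N_supported_zero[OF _ x0] by (auto simp: f_def vec_eq_iff)
  ultimately obtain e where e: "e > 0" "\<forall>y\<in>N. norm (f y) \<ge> e * norm y"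
    using injective_imp_isometric[OF closed_subspace[OF subspace_N] subspace_N, of f]
    by (auto simp: linear_conv_bounded_linear)
  show ?thesis
  proof (rule that[of "1 / e"])
    show "1 / e > 0" using e by simp
    fix y assume "y \<in> N"
    then have "e * norm y \<le> norm (f y)" using e by blast
    also have "\<dots> \<le> (\<Sum>i\<in>UNIV. \<bar>f y $ i\<bar>)"
      by (rule norm_le_l1_cart)
    also have "\<dots> = (\<Sum>i\<in>UNIV. slack x0 i * \<bar>y $ i\<bar>)"
      using slack_nonneg[OF x0] by (simp add: f_def abs_mult)
    finally show "norm y \<le> 1 / e * (\<Sum>i\<in>UNIV. slack x0 i * \<bar>y $ i\<bar>)"
      using e by (simp add: field_simps)
  qed
qed

end

section \<open>Rescaling a vector into the polytope\<close>

text \<open>Linear growth in \<open>\<bar>y\<bar>\<close>, here of the summands of the function that is minimized below, and in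
  \<open>mult_exp_minus_ge\<close> of the summands of the orthogonality relation that its critical points satisfy.\<close>

lemma exp_minus_linear_ge:
  fixes c t y :: real
  assumes "c > 0" "t \<ge> 0"
  shows "t * \<bar>y\<bar> - 2 * t\<^sup>2 / c \<le> c * exp y - t * y"
proof (cases "y \<ge> 0")
  case True
  have "y\<^sup>2 / 2 \<le> exp y"
    using exp_lower_Taylor_quadratic[OF True] True by linarith
  then have "c * (y\<^sup>2 / 2) \<le> c * exp y"
    using assms by (intro mult_left_mono) auto
  moreover have "c * (y\<^sup>2 / 2) - 2 * t * y + 2 * t\<^sup>2 / c = c / 2 * (y - 2 * t / c)\<^sup>2"
    using assms by (simp add: field_simps power2_eq_square)
  moreover have "c / 2 * (y - 2 * t / c)\<^sup>2 \<ge> 0"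
    using assms by simp
  ultimately show ?thesis
    using True by (simp add: algebra_simps)
next
  case False
  have "c * exp y \<ge> 0" "2 * t\<^sup>2 / c \<ge> 0"
    using assms by auto
  then show ?thesis
    using False by simp
qed

lemma mult_exp_ge:
  fixes s y :: real
  assumes "s \<ge> 0"
  shows "- s \<le> s * (y * exp y)"
proof -
  have "- y \<le> exp (- y)"
    using exp_ge_add_one_self[of "- y"] by simp
  then have "- y * exp y \<le> exp (- y) * exp y"
    by (intro mult_right_mono) auto
  then have "- 1 \<le> y * exp y"
    by (simp add: exp_minus_inverse mult.commute)
  then show ?thesis
    using mult_left_mono[OF _ assms, of "- 1"] by simp
qed

lemma mult_exp_minus_ge:
  fixes c s t y :: real
  assumes "c > 0" "c \<le> s" "t \<ge> 0"
  shows "t * \<bar>y\<bar> - s - t\<^sup>2 / c \<le> y * (s * exp y - t)"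
proof (cases "y \<ge> 0")
  case True
  have "y * y \<le> y * exp y"
    using exp_ge_add_one_self[of y] True by (intro mult_left_mono) linarith+
  then have "c * (y * y) \<le> s * (y * exp y)"
    by (rule mult_mono[OF assms(2)]) (use assms in auto)
  moreover have "c * (y * y) - 2 * t * y + t\<^sup>2 / c \<ge> 0"
  proof -
    have "c * (y * y) - 2 * t * y + t\<^sup>2 / c = c * (y - t / c)\<^sup>2"
      using assms by (simp add: field_simps power2_eq_square)
    then show ?thesis
      using assms by simp
  qed
  ultimately show ?thesis
    using True assms by (simp add: algebra_simps)
next
  case False
  have "s * (y * exp y) \<ge> - s"
    using mult_exp_ge[of s y] assms by simp
  moreover have "t\<^sup>2 / c \<ge> 0"
    using assms by auto
  ultimately show ?thesis
    using False by (simp add: algebra_simps)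
qed

context generic_polytope
begin

lemma N_scaling_unique:
  assumes x: "x \<in> P" and x': "x' \<in> P" and y: "y \<in> N"
    and scale: "\<And>i. slack x' i = exp (y $ i) * slack x i"
  shows "y = 0"
proof -
  \<comment> \<open>Both factors of each summand have the same sign, so orthogonality kills every summand.\<close>
  have "(\<Sum>i | essential i. y $ i * (slack x' i - slack x i)) = 0"
    using N_orthogonal_slack[OF y] .
  moreover have nonneg: "y $ i * (slack x' i - slack x i) \<ge> 0" for i
  proof -
    have "y $ i * (exp (y $ i) - 1) \<ge> 0"
      by (cases "y $ i \<ge> 0") (auto intro: mult_nonneg_nonneg mult_nonpos_nonpos)
    then have "y $ i * (exp (y $ i) - 1) * slack x i \<ge> 0"
      using slack_nonneg[OF x] by (rule mult_nonneg_nonneg)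
    then show ?thesis
      by (simp add: scale algebra_simps)
  qed
  ultimately have "\<forall>i\<in>{i. essential i}. y $ i * (slack x' i - slack x i) = 0"
    by (subst (asm) sum_nonneg_eq_0_iff) auto
  then have zero: "y $ i = 0" if "essential i" "slack x i \<noteq> 0" for i
    using that by (auto simp: scale)
  define y' where "y' = (\<chi> i. if essential i then y $ i else 0)"
  have "y' \<in> N"
    using y by (rule N_cong) (simp add: y'_def)
  then have "y' = 0"
    using zero by (intro N_supported_zero[OF _ x]) (auto simp: y'_def)
  then have ess: "y $ i = 0" if "essential i" for i
  proof -
    have "y' $ i = 0"
      by (simp add: \<open>y' = 0\<close>)
    then show ?thesis
      using that by (simp add: y'_def)
  qed
  have "dual_map (x' - x) = 0"
    using ess scale by (auto simp: dual_map_def vec_eq_iff g_eq slack_diff[symmetric])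
  then have "x' = x"
    using dual_map_inj[of "x' - x"] x x' subspace_E by (auto simp: P_iff subspace_diff)
  then have "y $ i = 0" if "\<not> essential i" for i
    using scale[of i] ghost_slack_pos[OF x that] by simp
  then show ?thesis
    using ess by (auto simp: vec_eq_iff)
qed

text \<open>The function \<open>\<Sum>i. r\<^sub>i exp y\<^sub>i - b\<^sub>i y\<^sub>i\<close>, summed over the essential indices, is coercive on
  the kernel vectors that vanish at the ghosts, and its critical points there solve the equation in the
  essential coordinates.  At a ghost \<open>y\<close> is unconstrained, so the equation can be solved directly.
  For the coercivity, \<open>b\<close> is replaced by the slack vector of a point \<open>x0\<close> of the face where \<open>r\<close>
  vanishes: on the kernel this does not change the function, and it makes each summand bounded below.\<close>

lemma N_scaling_exists:
  fixes r :: "real^'m"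
  assumes r: "\<And>i. r $ i \<ge> 0" and zeros: "{i. r $ i = 0} \<in> K"
  obtains y x where "y \<in> N" "x \<in> P" "\<And>i. slack x i = exp (y $ i) * r $ i"
proof -
  obtain x0 where x0: "x0 \<in> P" and x0r: "\<And>i. r $ i = 0 \<Longrightarrow> slack x0 i = 0"
    using zeros unfolding K_iff by auto
  define N' where "N' = {y \<in> N. \<forall>i. \<not> essential i \<longrightarrow> y $ i = 0}"
  define f where "f = (\<lambda>y::real^'m. \<Sum>i | essential i. r $ i * exp (y $ i) - slack x0 i * y $ i)"
  define C where "C = (\<Sum>i\<in>UNIV. 2 * (slack x0 i)\<^sup>2 / r $ i)"
  have C_nonneg: "2 * (slack x0 i)\<^sup>2 / r $ i \<ge> 0" for i
    using r by simp
  obtain \<kappa> where \<kappa>: "\<kappa> > 0" "\<And>y. y \<in> N \<Longrightarrow> norm y \<le> \<kappa> * (\<Sum>i\<in>UNIV. slack x0 i * \<bar>y $ i\<bar>)"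
    using N_bound[OF x0] by metis
  have f_ge: "(\<Sum>i\<in>UNIV. slack x0 i * \<bar>y $ i\<bar>) - C \<le> f y" if y: "y \<in> N'" for y
  proof -
    have term_ge: "slack x0 i * \<bar>y $ i\<bar> - 2 * (slack x0 i)\<^sup>2 / r $ i \<le> r $ i * exp (y $ i) - slack x0 i * y $ i"
      for i
      using exp_minus_linear_ge[of "r $ i" "slack x0 i" "y $ i"] r[of i] x0r[of i] slack_nonneg[OF x0, of i]
      by (cases "r $ i = 0") auto
    have "(\<Sum>i\<in>UNIV. slack x0 i * \<bar>y $ i\<bar>) = (\<Sum>i | essential i. slack x0 i * \<bar>y $ i\<bar>)"
      using y by (intro sum.mono_neutral_right) (auto simp: N'_def)
    moreover have "(\<Sum>i | essential i. 2 * (slack x0 i)\<^sup>2 / r $ i) \<le> C"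
      unfolding C_def using C_nonneg by (intro sum_mono2) auto
    moreover have "(\<Sum>i | essential i. slack x0 i * \<bar>y $ i\<bar> - 2 * (slack x0 i)\<^sup>2 / r $ i) \<le> f y"
      unfolding f_def by (intro sum_mono term_ge)
    ultimately show ?thesis
      by (simp add: sum_subtractf)
  qed
  have zero: "0 \<in> N'"
    using subspace_N by (simp add: N'_def subspace_0)
  define R where "R = \<kappa> * (f 0 + C)"
  have N'_norm: "norm y \<le> R" if "y \<in> N'" "f y \<le> f 0" for y
  proof -
    have "norm y \<le> \<kappa> * (\<Sum>i\<in>UNIV. slack x0 i * \<bar>y $ i\<bar>)"
      using \<kappa>(2) that(1) by (simp add: N'_def)
    also have "\<dots> \<le> R"
      unfolding R_def using f_ge[OF that(1)] that(2) \<kappa>(1) by (intro mult_left_mono) auto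
    finally show ?thesis .
  qed
  have "N' = N \<inter> (\<Inter>i\<in>{i. \<not> essential i}. {y. y $ i = 0})"
    by (auto simp: N'_def)
  then have "closed N'"
    using closed_subspace[OF subspace_N]
    by (auto intro!: closed_Int closed_INT closed_Collect_eq continuous_intros)
  then have "compact (N' \<inter> cball 0 R)"
    by (intro closed_Int_compact compact_cball)
  moreover have "0 \<in> N' \<inter> cball 0 R"
    using N'_norm[OF zero] zero by simp
  moreover have "continuous_on (N' \<inter> cball 0 R) f"
    unfolding f_def by (intro continuous_intros)
  ultimately obtain ym where ym: "ym \<in> N' \<inter> cball 0 R" "\<And>y. y \<in> N' \<inter> cball 0 R \<Longrightarrow> f ym \<le> f y"
    using continuous_attains_inf[of "N' \<inter> cball 0 R" f] by blast
  have min: "f ym \<le> f y" if "y \<in> N'" for y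
  proof (cases "f y \<le> f 0")
    case True
    then show ?thesis
      using ym(2) that N'_norm by simp
  next
    case False
    then show ?thesis
      using ym(2)[of 0] \<open>0 \<in> N' \<inter> cball 0 R\<close> by simp
  qed
  have critical: "(\<Sum>i | essential i. v $ i * (r $ i * exp (ym $ i) - slack x0 i)) = 0" if v: "v \<in> N'" for v
  proof -
    have der: "((\<lambda>\<tau>. f (ym + \<tau> *\<^sub>R v)) has_real_derivative
        (\<Sum>i | essential i. r $ i * (exp (ym $ i + 0 * v $ i) * v $ i) - slack x0 i * v $ i)) (at 0)"
      unfolding f_def vector_add_component vector_scaleR_component real_scaleR_def
      by (intro DERIV_sum) (auto intro!: derivative_eq_intros simp: algebra_simps)
    have "f (ym + 0 *\<^sub>R v) \<le> f (ym + \<tau> *\<^sub>R v)" for \<tau>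
    proof -
      have "ym + \<tau> *\<^sub>R v \<in> N'"
        using ym(1) v subspace_N by (auto simp: N'_def subspace_add subspace_scale)
      then show ?thesis
        using min by simp
    qed
    then have "(\<Sum>i | essential i. r $ i * (exp (ym $ i + 0 * v $ i) * v $ i) - slack x0 i * v $ i) = 0"
      by (intro DERIV_local_min[OF der, of 1]) auto
    moreover have "(\<Sum>i | essential i. r $ i * (exp (ym $ i + 0 * v $ i) * v $ i) - slack x0 i * v $ i)
        = (\<Sum>i | essential i. v $ i * (r $ i * exp (ym $ i) - slack x0 i))"
      by (intro sum.cong) (simp_all add: algebra_simps)
    ultimately show ?thesis by simp
  qed
  define s where "s = (\<chi> i. if essential i then r $ i * exp (ym $ i) - slack x0 i else 0)"
  have "y \<bullet> s = 0" if "y \<in> N" for y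
  proof -
    define v where "v = (\<chi> i. if essential i then y $ i else 0)"
    have "v \<in> N'"
      unfolding N'_def using N_cong[OF that, of v] by (simp add: v_def)
    have "y \<bullet> s = (\<Sum>i | essential i. v $ i * (r $ i * exp (ym $ i) - slack x0 i))"
      unfolding inner_vec_def by (intro sum.mono_neutral_cong_right) (auto simp: s_def v_def)
    then show ?thesis
      using critical[OF \<open>v \<in> N'\<close>] by simp
  qed
  then obtain x1 where x1: "x1 \<in> E" "s = dual_map x1"
    using orthogonal_to_N by blast
  define x where "x = x0 + x1"
  have slack_x: "slack x i = r $ i * exp (ym $ i)" if "essential i" for i
  proof -
    have "a i \<bullet> x1 = s $ i"
      using x1(2) that by (simp add: dual_map_def g_eq)
    then have "slack x i - slack x0 i = s $ i"
      by (simp add: slack_diff x_def)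
    then show ?thesis
      using that by (simp add: s_def)
  qed
  have x: "x \<in> P"
  proof (rule in_P_if_essential)
    show "x \<in> E"
      using x0 x1(1) subspace_E by (simp add: x_def P_iff subspace_add)
    show "slack x i \<ge> 0" if "essential i" for i
      using slack_x[OF that] r[of i] by simp
  qed
  define y where "y = (\<chi> i. if essential i then ym $ i else ln (slack x i / r $ i))"
  have "y \<in> N"
    by (rule N_cong[of ym]) (use ym(1) in \<open>auto simp: N'_def y_def\<close>)
  moreover have "slack x i = exp (y $ i) * r $ i" for i
  proof (cases "essential i")
    case True
    then show ?thesis
      by (simp add: slack_x y_def)
  next
    case False
    then have "{i} \<notin> K"
      by (simp add: essential_def)
    then have "r $ i \<noteq> 0"
      using K_subset[OF zeros, of "{i}"] by auto
    then show ?thesis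
      using False ghost_slack_pos[OF x False] r[of i] by (simp add: y_def)
  qed
  ultimately show ?thesis
    using that x by blast
qed

text \<open>The slack vector obtained by rescaling is compared with that of
  a point \<open>x0\<close> of the face where \<open>r0\<close> vanishes; only the coordinates at which \<open>x0\<close> has positive slack
  have to be controlled, and there \<open>r0\<close> is positive.\<close>

lemma N_scaling_locally_bounded:
  fixes r0 :: "real^'m"
  assumes r0: "\<And>i. r0 $ i \<ge> 0" and zeros: "{i. r0 $ i = 0} \<in> K"
  obtains \<delta> B where "\<delta> > 0"
    "\<And>r y x. (\<And>i. r $ i \<ge> 0) \<Longrightarrow> dist r r0 < \<delta> \<Longrightarrow> y \<in> N \<Longrightarrow> x \<in> P \<Longrightarrow>
       (\<And>i. slack x i = exp (y $ i) * r $ i) \<Longrightarrow> norm y \<le> B"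
proof -
  obtain x0 where x0: "x0 \<in> P" and x0r: "\<And>i. r0 $ i = 0 \<Longrightarrow> slack x0 i = 0"
    using zeros unfolding K_iff by auto
  obtain \<kappa> where \<kappa>: "\<kappa> > 0" "\<And>y. y \<in> N \<Longrightarrow> norm y \<le> \<kappa> * (\<Sum>i\<in>UNIV. slack x0 i * \<bar>y $ i\<bar>)"
    using N_bound[OF x0] by metis
  define \<delta> where "\<delta> = Min (insert 1 ((\<lambda>i. r0 $ i / 2) ` {i. r0 $ i > 0}))"
  have \<delta>: "\<delta> > 0"
    unfolding \<delta>_def by (subst Min_gr_iff) auto
  have \<delta>_le: "\<delta> \<le> 1" "\<And>i. r0 $ i > 0 \<Longrightarrow> \<delta> \<le> r0 $ i / 2"
    unfolding \<delta>_def by (rule Min_le; simp)+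
  have "\<exists>M. \<forall>x\<in>P. slack x i \<le> M" for i
    using continuous_attains_sup[OF compact_P P_nonempty continuous_slack] by blast
  then obtain M where M: "\<And>x i. x \<in> P \<Longrightarrow> slack x i \<le> M i"
    by metis
  have "\<exists>\<mu>>0. \<forall>x\<in>P. \<mu> \<le> slack x i" if "\<not> essential i" for i
    using continuous_attains_inf[OF compact_P P_nonempty continuous_slack[of _ i]] ghost_slack_pos[OF _ that]
    by metis
  then obtain \<mu> where \<mu>: "\<And>i. \<not> essential i \<Longrightarrow> \<mu> i > 0" "\<And>x i. \<not> essential i \<Longrightarrow> x \<in> P \<Longrightarrow> \<mu> i \<le> slack x i"
    by metis
  define B where "B = (\<lambda>i. if essential i then r0 $ i + 1 + (slack x0 i)\<^sup>2 / (r0 $ i / 2)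
      else slack x0 i * (M i / (r0 $ i / 2) + (r0 $ i + 1) / \<mu> i))"
  have "norm y \<le> \<kappa> * (\<Sum>i\<in>UNIV. B i)"
    if r: "\<And>i. r $ i \<ge> 0" and d: "dist r r0 < \<delta>" and y: "y \<in> N" and x: "x \<in> P"
      and sc: "\<And>i. slack x i = exp (y $ i) * r $ i" for r y x
  proof -
    have dr: "\<bar>r $ i - r0 $ i\<bar> < \<delta>" for i
      using dist_vec_nth_le[of r i r0] d by (simp add: dist_real_def)
    have r_upper: "r $ i \<le> r0 $ i + 1" for i
      using dr[of i] \<delta>_le(1) by linarith
    have r_lower: "r0 $ i / 2 \<le> r $ i" if "r0 $ i > 0" for i
      using dr[of i] \<delta>_le(2)[OF that] by linarith
    have ess: "slack x0 i * \<bar>y $ i\<bar> \<le> B i + y $ i * (slack x i - slack x0 i)" if "essential i" for i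
    proof (cases "r0 $ i = 0")
      case True
      then show ?thesis
        using mult_exp_ge[OF r[of i], of "y $ i"] r_upper[of i] x0r[OF True] that
        by (simp add: B_def sc algebra_simps)
    next
      case False
      then have pos: "r0 $ i > 0"
        using r0[of i] by simp
      have "slack x0 i * \<bar>y $ i\<bar> - r $ i - (slack x0 i)\<^sup>2 / (r0 $ i / 2) \<le> y $ i * (r $ i * exp (y $ i) - slack x0 i)"
        using pos r_lower[OF pos] slack_nonneg[OF x0] by (intro mult_exp_minus_ge) auto
      then show ?thesis
        using r_upper[of i] that by (simp add: B_def sc mult.commute)
    qed
    have ghost: "slack x0 i * \<bar>y $ i\<bar> \<le> B i" if gh: "\<not> essential i" for i
    proof -
      have pos: "r0 $ i > 0"
        using x0r[of i] ghost_slack_pos[OF x0 gh] r0[of i] by fastforce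
      have rp: "r $ i > 0"
        using r_lower[OF pos] pos by simp
      have "y $ i \<le> exp (y $ i)" "- y $ i \<le> exp (- y $ i)"
        using exp_ge_add_one_self[of "y $ i"] exp_ge_add_one_self[of "- y $ i"] by linarith+
      moreover have "exp (y $ i) \<le> M i / (r0 $ i / 2)"
      proof -
        have "exp (y $ i) = slack x i / r $ i"
          using sc[of i] rp by simp
        also have "\<dots> \<le> M i / (r0 $ i / 2)"
          using M[OF x, of i] r_lower[OF pos] pos slack_nonneg[OF x, of i] by (intro frac_le) linarith+
        finally show ?thesis .
      qed
      moreover have "exp (- y $ i) \<le> (r0 $ i + 1) / \<mu> i"
      proof -
        have "exp (- y $ i) = r $ i / slack x i"
          using sc[of i] rp by (simp add: exp_minus field_simps)
        also have "\<dots> \<le> (r0 $ i + 1) / \<mu> i"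
          using r_upper[of i] r0[of i] \<mu>(1)[OF gh] \<mu>(2)[OF gh x] rp by (intro frac_le) auto
        finally show ?thesis .
      qed
      moreover have "exp (y $ i) \<ge> 0" "exp (- y $ i) \<ge> 0" by simp_all
      ultimately have "\<bar>y $ i\<bar> \<le> M i / (r0 $ i / 2) + (r0 $ i + 1) / \<mu> i"
        by linarith
      then show ?thesis
        unfolding B_def using gh slack_nonneg[OF x0, of i] by (simp add: mult_left_mono)
    qed
    have "(\<Sum>i\<in>UNIV. slack x0 i * \<bar>y $ i\<bar>)
        \<le> (\<Sum>i\<in>UNIV. B i + (if essential i then y $ i * (slack x i - slack x0 i) else 0))"
      by (intro sum_mono) (use ess ghost in auto)
    also have "\<dots> = (\<Sum>i\<in>UNIV. B i)"
      using N_orthogonal_slack[OF y, of x x0] by (simp add: sum.distrib sum.If_cases)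
    finally have "\<kappa> * (\<Sum>i\<in>UNIV. slack x0 i * \<bar>y $ i\<bar>) \<le> \<kappa> * (\<Sum>i\<in>UNIV. B i)"
      using \<kappa>(1) by (intro mult_left_mono) auto
    then show ?thesis
      using \<kappa>(2)[OF y] by simp
  qed
  then show ?thesis
    using that[OF \<delta>] by metis
qed

end

section \<open>The group attached to an admissible map\<close>

lemma Re_vec_add: "Re_vec (x + y) = Re_vec x + Re_vec y"
  by (simp add: Re_vec_def vec_eq_iff)

lemma Re_vec_scaleR: "Re_vec (c *\<^sub>R x) = c *\<^sub>R Re_vec x"
  by (simp add: Re_vec_def vec_eq_iff)

lemma exp_vec_add: "exp_vec (x + y) = exp_vec x * exp_vec y"
  by (simp add: exp_vec_def vec_eq_iff exp_add)

locale admissible_polytope = generic_polytope E a b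
  for E :: "'v::euclidean_space set" and a :: "'m::finite \<Rightarrow> 'v" and b +
  fixes \<Psi> :: "complex^'l::finite \<Rightarrow> complex^'m"
  assumes admissible: "admissible_Psi E a b \<Psi>"
    and card_m: "CARD('m) = dim E + 2 * CARD('l)"
begin

abbreviation Z :: "(complex^'m) set" where "Z \<equiv> moment_angle_manifold E a b"
abbreviation U :: "(complex^'m) set" where "U \<equiv> coord_arrangement_complement K"

definition e :: "complex^'l \<Rightarrow> complex^'m" where "e = exp_vec \<circ> \<Psi>"

lemma linear_\<Psi>: "Vector_Spaces.linear (*s) (*s) \<Psi>"
  using admissible by (simp add: admissible_Psi_def)

lemma \<Psi>_add: "\<Psi> (x + y) = \<Psi> x + \<Psi> y" and \<Psi>_scale: "\<Psi> (c *s x) = c *s \<Psi> x"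
  using linear_\<Psi> by (simp_all add: vec_linear_iff)

lemma \<Psi>_0: "\<Psi> 0 = 0"
  using \<Psi>_add[of 0 0] by simp

lemma \<Psi>_minus: "\<Psi> (- x) = - \<Psi> x"
  using \<Psi>_add[of x "- x"] by (simp add: \<Psi>_0 eq_neg_iff_add_eq_0 add.commute)

lemma \<Psi>_diff: "\<Psi> (x - y) = \<Psi> x - \<Psi> y"
  using \<Psi>_add[of x "- y"] by (simp add: \<Psi>_minus)

lemma continuous_\<Psi>: "continuous_on S \<Psi>"
  by (rule linear_continuous_on[OF vec_linear_imp_bounded_linear[OF linear_\<Psi>]])

definition Re\<Psi> :: "complex^'l \<Rightarrow> real^'m" where "Re\<Psi> w = Re_vec (\<Psi> w)"

lemma linear_Re\<Psi>: "linear Re\<Psi>"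
  using vec_linear_imp_real_linear[OF linear_\<Psi>]
  by (auto simp: Re\<Psi>_def linear_iff Re_vec_add Re_vec_scaleR)

lemma inj_Re\<Psi>: "inj Re\<Psi>"
proof -
  have "Re\<Psi> = Re_vec \<circ> \<Psi>"
    by (simp add: fun_eq_iff Re\<Psi>_def)
  then show ?thesis
    using admissible by (simp add: admissible_Psi_def)
qed

lemma range_Re\<Psi>: "range Re\<Psi> = N"
proof -
  have "range Re\<Psi> \<subseteq> N"
    using admissible by (auto simp: admissible_Psi_def Re\<Psi>_def N_def)
  moreover have "dim (range Re\<Psi>) = 2 * CARD('l)"
    using dim_image_eq[OF linear_Re\<Psi>, of UNIV] inj_Re\<Psi> by simp
  then have "dim N \<le> dim (range Re\<Psi>)"
    using dim_N card_m by simp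
  ultimately show ?thesis
    using linear_subspace_image[OF linear_Re\<Psi> subspace_UNIV] subspace_N
    by (intro subspace_dim_equal)
qed

lemma e_nth: "e w $ i = exp (\<Psi> w $ i)"
  by (simp add: e_def exp_vec_def)

lemma cmod_e: "cmod (e w $ i) = exp (Re\<Psi> w $ i)"
  by (simp add: e_nth Re\<Psi>_def Re_vec_def)

lemma continuous_e: "continuous_on S e"
proof -
  have "continuous_on S (\<lambda>w. \<chi> i. exp (\<Psi> w $ i))"
    by (intro continuous_intros continuous_\<Psi>)
  then show ?thesis
    by (simp add: e_def exp_vec_def comp_def)
qed

lemma U_iff: "z \<in> U \<longleftrightarrow> {i. z $ i = 0} \<in> K"
proof
  assume "z \<in> U"
  then obtain I where I: "I \<in> K" "\<And>j. j \<notin> I \<Longrightarrow> z $ j \<noteq> 0"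
    by (auto simp: coord_arrangement_complement_def polyhedral_product_def)
  then show "{i. z $ i = 0} \<in> K"
    by (intro K_subset[OF I(1)] subsetI) (use I(2) in blast)
next
  assume "{i. z $ i = 0} \<in> K"
  then show "z \<in> U"
    unfolding coord_arrangement_complement_def polyhedral_product_def
    by (intro UN_I[of "{i. z $ i = 0}"]) simp_all
qed

lemma open_U: "open U"
proof -
  have "open {x::complex^'m. \<forall>j. j \<notin> I \<longrightarrow> x $ j \<noteq> 0}" for I
  proof -
    have "{x::complex^'m. \<forall>j. j \<notin> I \<longrightarrow> x $ j \<noteq> 0} = (\<Inter>j\<in>- I. {x. x $ j \<noteq> 0})"
      by auto
    then show ?thesis
      by (auto intro!: open_INT open_Collect_neq continuous_intros)
  qed
  then show ?thesis
    by (auto simp: coord_arrangement_complement_def polyhedral_product_def)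
qed

sublocale vector_group_action e U
proof
  show "open U" by (rule open_U)
  show "e 0 = 1" by (simp add: vec_eq_iff e_nth \<Psi>_0)
  show "e (v + w) = e v * e w" for v w
    by (simp add: e_def \<Psi>_add exp_vec_add)
  show "e w * z \<in> U" if "z \<in> U" for z w
    using that by (simp add: U_iff e_nth)
qed

section \<open>The moment-angle manifold is a slice\<close>

lemma Z_iff: "z \<in> Z \<longleftrightarrow> (\<exists>x\<in>P. \<forall>i. slack x i = (cmod (z $ i))\<^sup>2)"
proof -
  have "(\<chi> i. (cmod (z $ i))\<^sup>2) = polytope_map a b x \<longleftrightarrow> (\<forall>i. slack x i = (cmod (z $ i))\<^sup>2)" for x
    by (auto simp: polytope_map_def slack_def vec_eq_iff)
  then show ?thesis
    by (simp add: moment_angle_manifold_def image_iff)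
qed

lemma Z_subset_U: "Z \<subseteq> U"
proof
  fix z assume "z \<in> Z"
  then obtain x where "x \<in> P" "\<And>i. slack x i = (cmod (z $ i))\<^sup>2"
    by (auto simp: Z_iff)
  then show "z \<in> U"
    unfolding U_iff K_iff by (intro bexI[of _ x]) auto
qed

lemma closed_Z: "closed Z"
proof -
  have "compact (polytope_map a b ` P)"
    unfolding polytope_map_def by (intro compact_continuous_image compact_P continuous_intros)
  then have "closed ((\<lambda>z::complex^'m. \<chi> i. (cmod (z $ i))\<^sup>2) -` (polytope_map a b ` P))"
    by (intro closed_vimage compact_imp_closed continuous_intros)
  then show ?thesis
    by (simp add: moment_angle_manifold_def vimage_def)
qed

lemma e_mult_in_Z_iff:
  "e w * z \<in> Z \<longleftrightarrow> (\<exists>x\<in>P. \<forall>i. slack x i = exp ((2 *\<^sub>R Re\<Psi> w) $ i) * (cmod (z $ i))\<^sup>2)"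
  by (simp add: Z_iff norm_mult cmod_e power_mult_distrib exp_double[symmetric])

lemma Re\<Psi>_in_N: "2 *\<^sub>R Re\<Psi> w \<in> N"
  using range_Re\<Psi> subspace_N by (metis rangeI subspace_scale)

text \<open>The action rescales the squared absolute values by the exponential of an element of \<open>N\<close>, and
  every element of \<open>N\<close> occurs.\<close>

lemma orbit_meets_Z:
  assumes "z \<in> U"
  shows "\<exists>w. e w * z \<in> Z"
proof -
  have "{i. (\<chi> i. (cmod (z $ i))\<^sup>2) $ i = 0} \<in> K"
    using assms by (simp add: U_iff)
  then obtain y x where y: "y \<in> N" "x \<in> P" "\<And>i. slack x i = exp (y $ i) * (\<chi> i. (cmod (z $ i))\<^sup>2) $ i"
    using N_scaling_exists[of "\<chi> i. (cmod (z $ i))\<^sup>2"] by auto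
  have "(1/2) *\<^sub>R y \<in> range Re\<Psi>"
    using y(1) subspace_N by (simp add: range_Re\<Psi> subspace_scale)
  then obtain w where "(1/2) *\<^sub>R y = Re\<Psi> w"
    by blast
  then have "y = 2 *\<^sub>R Re\<Psi> w"
    by (simp flip: \<open>_ = Re\<Psi> w\<close>)
  then show ?thesis
    using y by (auto simp: e_mult_in_Z_iff)
qed

lemma orbit_meets_Z_once:
  assumes "e v * z \<in> Z" "e w * z \<in> Z"
  shows "v = w"
proof -
  obtain x where x: "x \<in> P" "\<And>i. slack x i = exp ((2 *\<^sub>R Re\<Psi> v) $ i) * (cmod (z $ i))\<^sup>2"
    using assms(1) by (auto simp: e_mult_in_Z_iff)
  obtain x' where x': "x' \<in> P" "\<And>i. slack x' i = exp ((2 *\<^sub>R Re\<Psi> w) $ i) * (cmod (z $ i))\<^sup>2"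
    using assms(2) by (auto simp: e_mult_in_Z_iff)
  have diff: "2 *\<^sub>R Re\<Psi> (w - v) = 2 *\<^sub>R Re\<Psi> w - 2 *\<^sub>R Re\<Psi> v"
    by (simp add: linear_diff[OF linear_Re\<Psi>] scaleR_diff_right)
  have "slack x' i = exp ((2 *\<^sub>R Re\<Psi> (w - v)) $ i) * slack x i" for i
    unfolding x(2) x'(2) diff by (simp add: exp_diff)
  then have "2 *\<^sub>R Re\<Psi> (w - v) = 0"
    by (rule N_scaling_unique[OF x(1) x'(1) Re\<Psi>_in_N])
  then have "Re\<Psi> w = Re\<Psi> v"
    by (simp add: linear_diff[OF linear_Re\<Psi>])
  then show ?thesis
    using inj_Re\<Psi> by (simp add: inj_eq)
qed

definition \<eta> :: "complex^'m \<Rightarrow> complex^'l" where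
  "\<eta> u = (THE w. e w * u \<in> Z)"

lemma \<eta>_eq: "e w * u \<in> Z \<Longrightarrow> \<eta> u = w"
  unfolding \<eta>_def using orbit_meets_Z_once by (intro the_equality)

lemma \<eta>_in_Z: "u \<in> U \<Longrightarrow> e (\<eta> u) * u \<in> Z"
  using orbit_meets_Z \<eta>_eq by metis

lemma \<eta>_locally_bounded:
  assumes "u0 \<in> U"
  obtains \<epsilon> B where "\<epsilon> > 0" "cball u0 \<epsilon> \<subseteq> U" "\<And>u. u \<in> cball u0 \<epsilon> \<Longrightarrow> norm (\<eta> u) \<le> B"
proof -
  define sq where "sq = (\<lambda>z::complex^'m. (\<chi> i. (cmod (z $ i))\<^sup>2) :: real^'m)"
  have "{i. sq u0 $ i = 0} \<in> K"
    using assms by (simp add: U_iff sq_def)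
  moreover have "sq u0 $ i \<ge> 0" for i
    by (simp add: sq_def)
  ultimately obtain \<delta> B where \<delta>: "\<delta> > 0" and B:
    "\<And>r y x. (\<And>i. r $ i \<ge> 0) \<Longrightarrow> dist r (sq u0) < \<delta> \<Longrightarrow> y \<in> N \<Longrightarrow> x \<in> P \<Longrightarrow>
       (\<And>i. slack x i = exp (y $ i) * r $ i) \<Longrightarrow> norm y \<le> B"
    using N_scaling_locally_bounded[of "sq u0"] by metis
  obtain c where c: "c > 0" "\<And>w. norm (Re\<Psi> w) \<ge> c * norm w"
    using injective_imp_isometric[OF closed_UNIV subspace_UNIV, of Re\<Psi>] linear_Re\<Psi> inj_Re\<Psi>
    by (auto simp: linear_conv_bounded_linear linear_injective_0)
  have "continuous_on UNIV sq"
    unfolding sq_def by (intro continuous_intros)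
  then have "isCont sq u0"
    by (simp add: continuous_on_eq_continuous_at)
  then obtain \<epsilon>1 where \<epsilon>1: "\<epsilon>1 > 0" "\<And>u. dist u u0 < \<epsilon>1 \<Longrightarrow> dist (sq u) (sq u0) < \<delta>"
    using \<delta> by (auto simp: continuous_at_eps_delta)
  obtain \<epsilon>2 where \<epsilon>2: "\<epsilon>2 > 0" "cball u0 \<epsilon>2 \<subseteq> U"
    using open_U assms open_contains_cball by blast
  define \<epsilon> where "\<epsilon> = min (\<epsilon>1 / 2) \<epsilon>2"
  have \<epsilon>: "\<epsilon> > 0" "cball u0 \<epsilon> \<subseteq> U"
    using \<epsilon>1(1) \<epsilon>2 by (auto simp: \<epsilon>_def)
  have "norm (\<eta> u) \<le> B / (2 * c)" if u: "u \<in> cball u0 \<epsilon>" for u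
  proof -
    have "u \<in> U"
      using u \<epsilon>(2) by blast
    then obtain x where x: "x \<in> P" "\<And>i. slack x i = exp ((2 *\<^sub>R Re\<Psi> (\<eta> u)) $ i) * sq u $ i"
      using \<eta>_in_Z[of u] by (auto simp: e_mult_in_Z_iff sq_def)
    have "dist u u0 < \<epsilon>1"
      using u \<epsilon>1(1) by (auto simp: \<epsilon>_def dist_commute)
    then have "norm (2 *\<^sub>R Re\<Psi> (\<eta> u)) \<le> B"
      by (intro B[OF _ \<epsilon>1(2) Re\<Psi>_in_N x]) (simp_all add: sq_def)
    then have "2 * (c * norm (\<eta> u)) \<le> B"
      using c(2)[of "\<eta> u"] by simp
    then show ?thesis
      using c(1) by (simp add: field_simps)
  qed
  then show ?thesis
    using that \<epsilon> by blast
qed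

text \<open>Locally \<open>\<eta>\<close> takes values in a compact ball, and its graph is closed because \<open>Z\<close> is closed
  and meets each orbit only once.\<close>

lemma continuous_\<eta>: "continuous_on U \<eta>"
proof -
  have "isCont \<eta> u0" if "u0 \<in> U" for u0
  proof -
    obtain \<epsilon> B where \<epsilon>: "\<epsilon> > 0" "cball u0 \<epsilon> \<subseteq> U" and B: "\<And>u. u \<in> cball u0 \<epsilon> \<Longrightarrow> norm (\<eta> u) \<le> B"
      using \<eta>_locally_bounded[OF \<open>u0 \<in> U\<close>] by metis
    have "(\<lambda>u. (u, \<eta> u)) ` cball u0 \<epsilon> = {y. fst y \<in> cball u0 \<epsilon>} \<inter> {y. e (snd y) * fst y \<in> Z}"
      using \<eta>_in_Z \<eta>_eq \<epsilon>(2) by force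
    moreover have "closed {y :: (complex^'m) \<times> (complex^'l). fst y \<in> cball u0 \<epsilon>}"
      using closed_vimage[OF closed_cball continuous_on_fst[OF continuous_on_id]] by (simp add: vimage_def)
    moreover have "continuous_on UNIV (\<lambda>y :: (complex^'m) \<times> (complex^'l). e (snd y) * fst y)"
      by (intro continuous_on_vec_mult continuous_on_compose2[OF continuous_e[of UNIV]] continuous_intros) auto
    then have "closed {y :: (complex^'m) \<times> (complex^'l). e (snd y) * fst y \<in> Z}"
      using closed_vimage[OF closed_Z] by (simp add: vimage_def)
    ultimately have "closed ((\<lambda>u. (u, \<eta> u)) ` cball u0 \<epsilon>)"
      by (simp add: closed_Int)
    then have "continuous_on (cball u0 \<epsilon>) \<eta>"
      using B by (intro continuous_from_closed_graph[of "cball 0 B"]) auto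
    then show ?thesis
      using \<epsilon>(1) by (intro continuous_on_interior[of "cball u0 \<epsilon>"]) (auto simp: interior_cball)
  qed
  then show ?thesis
    by (simp add: continuous_at_imp_continuous_on)
qed

lemma \<eta>_e_mult: "u \<in> U \<Longrightarrow> \<eta> (e v * u) = \<eta> u - v"
proof (rule \<eta>_eq)
  assume "u \<in> U"
  have "e (\<eta> u - v) * (e v * u) = e (\<eta> u) * u"
    by (simp add: mult.assoc[symmetric] e_add[symmetric])
  then show "e (\<eta> u - v) * (e v * u) \<in> Z"
    using \<eta>_in_Z[OF \<open>u \<in> U\<close>] by simp
qed

text \<open>Moving \<open>u\<close> by \<open>v\<close> shortens the way to \<open>Z\<close> by \<open>v\<close>, whence the sign.\<close>

sublocale trivialized_action e U "\<lambda>u. - \<eta> u"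
proof
  show "continuous_on UNIV e" by (rule continuous_e)
  show "continuous_on U (\<lambda>u. - \<eta> u)" by (intro continuous_intros continuous_\<eta>)
  show "- \<eta> (e v * u) = v + - \<eta> u" if "u \<in> U" for u v
    using \<eta>_e_mult[OF that] by simp
qed

lemma slice_eq_Z: "slice = Z"
proof
  show "slice \<subseteq> Z"
    using \<eta>_in_Z by (force simp: slice_def e_0)
  show "Z \<subseteq> slice"
  proof
    fix z assume "z \<in> Z"
    then have "\<eta> z = 0"
      by (intro \<eta>_eq) (simp add: e_0)
    then show "z \<in> slice"
      using \<open>z \<in> Z\<close> Z_subset_U by (auto simp: slice_def)
  qed
qed

lemma action_holomorphic:
  "holomorphic_map_on (module_prod.scale (*s) (*s)) (*s) (\<lambda>(w, z). e w * z) (UNIV \<times> U)"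
  unfolding holomorphic_map_on_def
proof
  fix p :: "(complex^'l) \<times> (complex^'m)"
  define D where "D = (\<lambda>h. (\<chi> i. e (fst p) $ i * snd h $ i + (e (fst p) $ i * \<Psi> (fst h) $ i) * snd p $ i) :: complex^'m)"
  have lin: "bounded_linear \<Psi>"
    using vec_linear_imp_bounded_linear[OF linear_\<Psi>] .
  have e': "((\<lambda>y. e (fst y) $ i) has_derivative (\<lambda>h. e (fst p) $ i * \<Psi> (fst h) $ i)) (at p)" for i
  proof -
    have "((\<lambda>y. \<Psi> (fst y) $ i) has_derivative (\<lambda>h. \<Psi> (fst h) $ i)) (at p)"
      by (intro bounded_linear.has_derivative[OF bounded_linear_vec_nth]
          bounded_linear.has_derivative[OF lin] has_derivative_fst has_derivative_ident)
    from has_derivative_compose[OF this DERIV_exp[unfolded has_field_derivative_def]]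
    show ?thesis
      by (simp add: e_nth)
  qed
  have "((\<lambda>y. e (fst y) * snd y) has_derivative D) (at p)"
  proof (rule has_derivative_vec)
    fix i
    have "((\<lambda>y. snd y $ i) has_derivative (\<lambda>h. snd h $ i)) (at p)"
      by (intro bounded_linear.has_derivative[OF bounded_linear_vec_nth] has_derivative_snd has_derivative_ident)
    from has_derivative_mult[OF e' this]
    show "((\<lambda>y. (e (fst y) * snd y) $ i) has_derivative (\<lambda>h. D h $ i)) (at p)"
      by (simp add: D_def)
  qed
  moreover interpret module_prod "(*s) :: complex \<Rightarrow> complex^'l \<Rightarrow> _" "(*s) :: complex \<Rightarrow> complex^'m \<Rightarrow> _"
    by unfold_locales
  have "vector_space (module_prod.scale (*s) (*s) :: complex \<Rightarrow> (complex^'l) \<times> (complex^'m) \<Rightarrow> _)"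
    by unfold_locales (auto simp: scale_def algebra_simps vec.scale_right_distrib vec.scale_left_distrib)
  then have "Vector_Spaces.linear (module_prod.scale (*s) (*s)) (*s) D"
    unfolding Vector_Spaces.linear_iff
    by (auto simp: vec.vector_space_axioms D_def vec_eq_iff scale_def \<Psi>_add \<Psi>_scale algebra_simps)
  ultimately show "\<exists>D. complex_derivative (module_prod.scale (*s) (*s)) (*s) (\<lambda>(w, z). e w * z) D p"
    unfolding complex_derivative_def split_beta by blast
qed

lemma free_proper_holomorphic: "free_proper_holomorphic_action e U"
proof -
  have "1 \<in> U"
    using P_nonempty by (auto simp: U_iff K_iff)
  then have inj: "inj e"
    using action_free by (metis injI)
  have free: "g' = 1" if "g' \<in> range e" "z \<in> U" "g' * z = z" for g' z
  proof -
    obtain w where w: "g' = e w"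
      using \<open>g' \<in> range e\<close> by auto
    have "w = 0"
      using action_free[OF \<open>z \<in> U\<close>, of w 0] \<open>g' * z = z\<close> by (simp add: w e_0)
    then show ?thesis
      by (simp add: w e_0)
  qed
  show ?thesis
    unfolding free_proper_holomorphic_action_def
    using open_U inj e_0 e_add e_mult_in_U free action_proper action_holomorphic
    by (intro conjI allI ballI impI; blast)
qed

end

section \<open>Complex differentiable scalar functions\<close>

text \<open>The coordinates of a holomorphic map between coordinate spaces, one at a time.\<close>

definition cdiff :: "(complex^'m::finite \<Rightarrow> complex) \<Rightarrow> complex^'m \<Rightarrow> bool" where
  "cdiff f z \<longleftrightarrow> (\<exists>D. (f has_derivative D) (at z) \<and> (\<forall>c h. D (c *s h) = c * D h))"

lemma cdiffI: "(f has_derivative D) (at z) \<Longrightarrow> (\<And>c h. D (c *s h) = c * D h) \<Longrightarrow> cdiff f z"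
  by (auto simp: cdiff_def)

lemma cdiff_const: "cdiff (\<lambda>z. c) z"
  by (rule cdiffI[OF has_derivative_const]) simp

lemma cdiff_nth: "cdiff (\<lambda>z. z $ i) z"
  by (rule cdiffI[OF bounded_linear_imp_has_derivative[OF bounded_linear_vec_nth]]) simp

lemma cdiff_diff:
  assumes "cdiff f z" "cdiff g z"
  shows "cdiff (\<lambda>z. f z - g z) z"
proof -
  obtain D D' where D: "(f has_derivative D) (at z)" "\<And>c h. D (c *s h) = c * D h"
    and D': "(g has_derivative D') (at z)" "\<And>c h. D' (c *s h) = c * D' h"
    using assms unfolding cdiff_def by metis
  show ?thesis
    by (rule cdiffI[OF has_derivative_diff[OF D(1) D'(1)]]) (simp add: D(2) D'(2) algebra_simps)
qed

lemma cdiff_mult: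
  assumes "cdiff f z" "cdiff g z"
  shows "cdiff (\<lambda>z. f z * g z) z"
proof -
  obtain D D' where D: "(f has_derivative D) (at z)" "\<And>c h. D (c *s h) = c * D h"
    and D': "(g has_derivative D') (at z)" "\<And>c h. D' (c *s h) = c * D' h"
    using assms unfolding cdiff_def by metis
  show ?thesis
    by (rule cdiffI[OF has_derivative_mult[OF D(1) D'(1)]]) (simp add: D(2) D'(2) algebra_simps)
qed

lemma cdiff_sum:
  assumes "\<And>i. i \<in> I \<Longrightarrow> cdiff (f i) z"
  shows "cdiff (\<lambda>z. \<Sum>i\<in>I. f i z) z"
proof -
  obtain D where D: "\<And>i. i \<in> I \<Longrightarrow> (f i has_derivative D i) (at z)"
    "\<And>i c h. i \<in> I \<Longrightarrow> D i (c *s h) = c * D i h"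
    using assms unfolding cdiff_def by metis
  show ?thesis
  proof (rule cdiffI)
    show "((\<lambda>z. \<Sum>i\<in>I. f i z) has_derivative (\<lambda>h. \<Sum>i\<in>I. D i h)) (at z)"
      by (intro has_derivative_sum D)
    show "(\<Sum>i\<in>I. D i (c *s h)) = c * (\<Sum>i\<in>I. D i h)" for c h
      by (simp add: D(2) sum_distrib_left)
  qed
qed

lemma cdiff_field_compose:
  assumes "cdiff f z" "(g has_field_derivative g') (at (f z))"
  shows "cdiff (\<lambda>z. g (f z)) z"
proof -
  obtain D where D: "(f has_derivative D) (at z)" "\<And>c h. D (c *s h) = c * D h"
    using assms(1) unfolding cdiff_def by metis
  from has_derivative_compose[OF D(1) assms(2)[unfolded has_field_derivative_def]]
  show ?thesis
    by (rule cdiffI) (simp add: D(2) mult.left_commute)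
qed

lemma cdiff_exp: "cdiff f z \<Longrightarrow> cdiff (\<lambda>z. exp (f z)) z"
  by (rule cdiff_field_compose[OF _ DERIV_exp])

lemma cdiff_linear:
  fixes T :: "complex^'n::finite \<Rightarrow> complex^'k::finite"
  assumes T: "Vector_Spaces.linear (*s) (*s) T" and F: "\<And>j. cdiff (\<lambda>z. F z $ j) z"
  shows "cdiff (\<lambda>z. T (F z) $ i) z"
  unfolding Cartesian_Space.linear_componentwise[OF T, of "F _"]
  by (intro cdiff_sum cdiff_mult F cdiff_const)

lemma complex_derivative_componentwise:
  fixes F :: "complex^'n::finite \<Rightarrow> complex^'k::finite"
  assumes "\<And>i. cdiff (\<lambda>z. F z $ i) z"
  shows "\<exists>D. complex_derivative (*s) (*s) F D z"
proof -
  obtain D where D: "\<And>i. ((\<lambda>z. F z $ i) has_derivative D i) (at z)" "\<And>i c h. D i (c *s h) = c * D i h"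
    using assms unfolding cdiff_def by metis
  have "(F has_derivative (\<lambda>h. \<chi> i. D i h)) (at z)"
    by (rule has_derivative_vec) (simp add: D(1))
  moreover have "Vector_Spaces.linear (*s) (*s) (\<lambda>h. \<chi> i. D i h)"
    using has_derivative_linear[OF D(1)]
    by (auto simp: vec_linear_iff vec_eq_iff D(2) linear_add)
  ultimately show ?thesis
    unfolding complex_derivative_def by blast
qed

text \<open>Near \<open>z\<close> a continuous logarithm of a coordinate differs by a constant from the principal
  logarithm of that coordinate divided by its value at \<open>z\<close>.\<close>

lemma cdiff_continuous_log:
  assumes cont: "isCont f z" and exp_f: "\<forall>\<^sub>F u in nhds z. exp (f u) = u $ i"
  shows "cdiff f z"
proof -
  have z: "exp (f z) = z $ i"
    using eventually_nhds_x_imp_x[OF exp_f] .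
  then have nz: "z $ i \<noteq> 0"
    by (metis exp_not_eq_zero)
  have "cdiff (\<lambda>u. u $ i * inverse (z $ i)) z"
    by (intro cdiff_mult cdiff_nth cdiff_const)
  moreover have "(Ln has_field_derivative 1) (at (z $ i * inverse (z $ i)))"
    using has_field_derivative_Ln[of 1] nz by simp
  ultimately have "cdiff (\<lambda>u. Ln (u $ i * inverse (z $ i))) z"
    by (rule cdiff_field_compose)
  from cdiff_diff[OF this cdiff_const[of "- f z"]]
  obtain D where D: "((\<lambda>u. Ln (u $ i * inverse (z $ i)) - (- f z)) has_derivative D) (at z)"
    "\<And>c h. D (c *s h) = c * D h"
    unfolding cdiff_def by metis
  have "\<forall>\<^sub>F u in at z. dist (f u) (f z) < pi"
    using cont pi_gt_zero unfolding isCont_def by (rule tendstoD)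
  moreover have "\<forall>\<^sub>F u in at z. exp (f u) = u $ i"
    using exp_f by (simp add: eventually_nhds_conv_at)
  ultimately have "\<forall>\<^sub>F u in at z. Ln (u $ i * inverse (z $ i)) - (- f z) = f u"
  proof eventually_elim
    case (elim u)
    have "\<bar>Im (f u - f z)\<bar> < pi"
      using elim(1) abs_Im_le_cmod[of "f u - f z"] unfolding dist_norm by linarith
    moreover have "u $ i * inverse (z $ i) = exp (f u - f z)"
      using elim(2) z by (simp add: exp_diff divide_inverse)
    ultimately show ?case
      by simp
  qed
  moreover have "Ln (z $ i * inverse (z $ i)) - (- f z) = f z"
    using nz by simp
  ultimately have "(f has_derivative D) (at z)"
    by (rule has_derivative_transform_eventually[OF D(1)]) simp
  then show ?thesis
    using D(2) by (rule cdiffI)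
qed

section \<open>Complements of complex subspaces\<close>

text \<open>The kernel of \<open>\<alpha>\<close> is a complement of the range of \<open>A\<close>; counting dimensions, it can be
  parametrized by the remaining coordinates.\<close>

lemma kernel_of_retraction:
  fixes A :: "complex^'l::finite \<Rightarrow> complex^'m::finite"
  assumes A: "Vector_Spaces.linear (*s) (*s) A" and \<alpha>: "Vector_Spaces.linear (*s) (*s) \<alpha>"
    and \<alpha>A: "\<And>w. \<alpha> (A w) = w" and card: "CARD('m) = CARD('l) + CARD('d::finite)"
  obtains L :: "complex^'d \<Rightarrow> complex^'m" and \<beta> :: "complex^'m \<Rightarrow> complex^'d"
  where "Vector_Spaces.linear (*s) (*s) L" "Vector_Spaces.linear (*s) (*s) \<beta>"
    "\<And>v. \<beta> (L v) = v" "\<And>v. \<alpha> (L v) = 0" "\<And>x. \<alpha> x = 0 \<Longrightarrow> L (\<beta> x) = x"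
proof -
  interpret A: Vector_Spaces.linear "(*s)" "(*s)" A by (rule A)
  interpret \<alpha>: Vector_Spaces.linear "(*s)" "(*s)" \<alpha> by (rule \<alpha>)
  let ?k = "{x. \<alpha> x = 0}"
  have sub: "vec.subspace ?k" "vec.subspace (range A)"
    by (rule \<alpha>.subspace_kernel, rule A.subspace_image, rule vec.subspace_UNIV)
  have "inj A"
    using \<alpha>A by (metis injI)
  then have "vec.dim (range A) = CARD('l)"
    using vec.dim_image_eq[OF A, of UNIV] by (simp add: card_cart_basis)
  moreover have "{x + y | x y. x \<in> range A \<and> y \<in> ?k} = UNIV"
  proof -
    have "z = A (\<alpha> z) + (z - A (\<alpha> z))" "\<alpha> (z - A (\<alpha> z)) = 0" for z
      by (simp_all add: \<alpha>.diff \<alpha>A)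
    then show ?thesis by blast
  qed
  moreover have "range A \<inter> ?k = {0}"
    using \<alpha>A by (auto simp: A.zero) (metis A.zero \<alpha>A rangeI)
  ultimately have dim: "vec.dim ?k = CARD('d)"
    using vec.dim_sums_Int[OF sub(2,1)] card by (simp add: card_cart_basis)
  then obtain L :: "complex^'d \<Rightarrow> complex^'m"
    where L: "Vector_Spaces.linear (*s) (*s) L" "range L = ?k" "inj L"
    using vec.subspace_isomorphism[OF vec.subspace_UNIV sub(1)] by (auto simp: card_cart_basis)
  obtain \<beta> where \<beta>: "Vector_Spaces.linear (*s) (*s) \<beta>" "\<beta> \<circ> L = id"
    using vec.linear_injective_left_inverse[OF L(1,3)] by blast
  have \<beta>L: "\<beta> (L v) = v" for v
    using \<beta>(2) by (metis comp_apply id_apply)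
  show ?thesis
  proof (rule that[OF L(1) \<beta>(1) \<beta>L])
    show "\<alpha> (L v) = 0" for v
      using L(2) by auto
    show "L (\<beta> x) = x" if "\<alpha> x = 0" for x
      using that L(2) \<beta>L by (metis (mono_tags, lifting) imageE mem_Collect_eq)
  qed
qed

section \<open>Holomorphic charts of the quotient\<close>

definition off :: "'m set \<Rightarrow> 'a::zero^'m::finite \<Rightarrow> 'a^'m" where
  "off J x = (\<chi> i. if i \<in> J then 0 else x $ i)"

lemma off_nth: "off J x $ i = (if i \<in> J then 0 else x $ i)"
  by (simp add: off_def)

lemma linear_off: "Vector_Spaces.linear (*s) (*s) (off J :: complex^'m::finite \<Rightarrow> _)"
  by (auto simp: vec_linear_iff off_def vec_eq_iff)

lemma linear_off_real: "linear (off J :: real^'m::finite \<Rightarrow> _)"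
  by (rule linearI) (auto simp: off_def vec_eq_iff)

text \<open>Where the coordinates outside a vertex \<open>J\<close> do not vanish, their logarithms turn the action
  into translation by \<open>off J (\<Psi> w)\<close>.  The real linear \<open>\<rho>\<close> recovers \<open>w\<close> from absolute
  values and is used to choose a branch of the logarithm that is compatible with the action; the complex
  linear \<open>\<alpha>\<close> then provides a holomorphic normal form on each orbit, with \<open>\<alpha> = 0\<close>, and \<open>L\<close>
  parametrizes \<open>\<alpha> = 0\<close>.\<close>

locale vertex_chart = admissible_polytope E a b \<Psi>
  for E :: "'v::euclidean_space set" and a :: "'m::finite \<Rightarrow> 'v" and b
    and \<Psi> :: "complex^'l::finite \<Rightarrow> complex^'m" +
  fixes J :: "'m set" and \<theta> :: "real^'m"
    and \<rho> :: "real^'m \<Rightarrow> complex^'l" and \<alpha> :: "complex^'m \<Rightarrow> complex^'l"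
    and L :: "complex^'d::finite \<Rightarrow> complex^'m" and \<beta> :: "complex^'m \<Rightarrow> complex^'d"
  assumes J_in_K: "J \<in> K"
    and linear_\<rho>: "linear \<rho>"
    and \<rho>_off_Re\<Psi>: "\<rho> (off J (Re\<Psi> w)) = w"
    and off_Re\<Psi>_\<rho>: "(\<And>i. i \<in> J \<Longrightarrow> y $ i = 0) \<Longrightarrow> off J (Re\<Psi> (\<rho> y)) = y"
    and linear_\<alpha>: "Vector_Spaces.linear (*s) (*s) \<alpha>"
    and \<alpha>_off_\<Psi>: "\<alpha> (off J (\<Psi> w)) = w"
    and \<alpha>_off: "\<alpha> (off J x) = \<alpha> x"
    and linear_L: "Vector_Spaces.linear (*s) (*s) L"
    and linear_\<beta>: "Vector_Spaces.linear (*s) (*s) \<beta>"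
    and \<beta>_L: "\<beta> (L v) = v"
    and \<alpha>_L: "\<alpha> (L v) = 0"
    and L_\<beta>: "\<alpha> x = 0 \<Longrightarrow> L (\<beta> x) = x"
begin

lemma \<alpha>_add: "\<alpha> (x + y) = \<alpha> x + \<alpha> y"
  using linear_\<alpha> by (simp add: vec_linear_iff)

lemma \<alpha>_diff: "\<alpha> (x - y) = \<alpha> x - \<alpha> y"
  using \<alpha>_add[of "x - y" y] by (simp add: algebra_simps)

definition ln_abs :: "complex^'m \<Rightarrow> real^'m" where
  "ln_abs z = off J (\<chi> i. ln (cmod (z $ i)))"

text \<open>The coordinates outside \<open>J\<close> after the action has moved their absolute values to \<open>1\<close>, turned
  back by the reference angles \<open>\<theta>\<close>.\<close>

definition phase :: "complex^'m \<Rightarrow> 'm \<Rightarrow> complex" where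
  "phase z i = z $ i * exp (- (\<Psi> (\<rho> (ln_abs z)) $ i) - \<i> * complex_of_real (\<theta> $ i))"

definition chart_dom :: "(complex^'m) set" where
  "chart_dom = {z. \<forall>i. i \<notin> J \<longrightarrow> z $ i \<noteq> 0 \<and> phase z i \<notin> \<real>\<^sub>\<le>\<^sub>0}"

text \<open>Taking the principal logarithm only of the invariant phase makes this branch equivariant.\<close>

definition branch :: "complex^'m \<Rightarrow> complex^'m" where
  "branch z = off J (\<chi> i. \<Psi> (\<rho> (ln_abs z)) $ i + \<i> * complex_of_real (\<theta> $ i) + Ln (phase z i))"

text \<open>The point of the orbit at which the branch lies in the kernel of \<open>\<alpha>\<close>, written with
  logarithmic coordinates outside \<open>J\<close>.\<close>

definition normal_form :: "complex^'m \<Rightarrow> complex^'m" where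
  "normal_form z = (\<chi> i. if i \<in> J then exp (- (\<Psi> (\<alpha> (branch z)) $ i)) * z $ i
     else branch z $ i - \<Psi> (\<alpha> (branch z)) $ i)"

definition coords :: "complex^'m \<Rightarrow> complex^'d" where
  "coords z = \<beta> (normal_form z)"

definition transversal :: "complex^'d \<Rightarrow> complex^'m" where
  "transversal v = (\<chi> i. if i \<in> J then L v $ i else exp (L v $ i))"

text \<open>Outside \<open>J\<close>, an argument of the phase of the transversal point with coordinates \<open>v\<close>.\<close>

definition angle :: "complex^'d \<Rightarrow> 'm \<Rightarrow> real" where
  "angle v i = Im (L v $ i - \<Psi> (\<rho> (off J (Re_vec (L v)))) $ i) - \<theta> $ i"

definition coord_box :: "(complex^'d) set" where
  "coord_box = {v. \<forall>i. i \<notin> J \<longrightarrow> \<bar>angle v i\<bar> < pi}"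

lemma ln_abs_e_mult:
  assumes "\<And>i. i \<notin> J \<Longrightarrow> z $ i \<noteq> 0"
  shows "ln_abs (e w * z) = off J (Re\<Psi> w) + ln_abs z"
  using assms by (auto simp: ln_abs_def off_def vec_eq_iff norm_mult cmod_e ln_mult)

lemma phase_e_mult:
  assumes "\<And>i. i \<notin> J \<Longrightarrow> z $ i \<noteq> 0"
  shows "\<rho> (ln_abs (e w * z)) = w + \<rho> (ln_abs z)" "phase (e w * z) i = phase z i"
proof -
  show \<rho>: "\<rho> (ln_abs (e w * z)) = w + \<rho> (ln_abs z)"
    using ln_abs_e_mult[OF assms] by (simp add: linear_add[OF linear_\<rho>] \<rho>_off_Re\<Psi>)
  show "phase (e w * z) i = phase z i"
    unfolding phase_def \<rho> by (simp add: \<Psi>_add e_nth exp_add[symmetric] mult.assoc mult.left_commute[of "exp _"])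
qed

lemma chart_dom_nonzero: "z \<in> chart_dom \<Longrightarrow> i \<notin> J \<Longrightarrow> z $ i \<noteq> 0"
  by (simp add: chart_dom_def)

lemma chart_dom_subset_U: "chart_dom \<subseteq> U"
proof
  fix z assume "z \<in> chart_dom"
  then have "{i. z $ i = 0} \<subseteq> J"
    using chart_dom_nonzero by blast
  then show "z \<in> U"
    unfolding U_iff by (rule K_subset[OF J_in_K])
qed

lemma saturated_chart_dom: "saturated chart_dom"
  unfolding saturated_def
proof (intro conjI allI ballI chart_dom_subset_U)
  fix w z assume z: "z \<in> chart_dom"
  show "e w * z \<in> chart_dom"
    using z phase_e_mult(2)[of z w] chart_dom_nonzero[OF z] unfolding chart_dom_def by (simp add: e_nth)
qed

lemma branch_e_mult:
  assumes "z \<in> chart_dom"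
  shows "branch (e w * z) = off J (\<Psi> w) + branch z"
proof -
  have ph: "\<rho> (ln_abs (e w * z)) = w + \<rho> (ln_abs z)" "\<And>i. phase (e w * z) i = phase z i"
    using phase_e_mult[of z w] chart_dom_nonzero[OF assms] by blast+
  show ?thesis
    unfolding branch_def ph(1) \<Psi>_add by (simp add: ph(2) vec_eq_iff off_nth)
qed

lemma coords_e_mult:
  assumes "z \<in> chart_dom"
  shows "coords (e w * z) = coords z"
proof -
  note branch = branch_e_mult[OF assms, of w]
  have \<alpha>: "\<alpha> (branch (e w * z)) = w + \<alpha> (branch z)"
    by (simp add: branch \<alpha>_add \<alpha>_off_\<Psi>)
  have "normal_form (e w * z) $ i = normal_form z $ i" for i
  proof (cases "i \<in> J")
    case True
    then show ?thesis
      by (simp add: normal_form_def \<alpha> \<Psi>_add e_nth mult.assoc[symmetric] exp_add[symmetric])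
  next
    case False
    then show ?thesis
      by (simp add: normal_form_def branch \<alpha>_add \<alpha>_off_\<Psi> \<Psi>_add off_nth)
  qed
  then have "normal_form (e w * z) = normal_form z"
    by (simp add: vec_eq_iff)
  then show ?thesis
    by (simp add: coords_def)
qed

lemma exp_branch:
  assumes "z \<in> chart_dom" "i \<notin> J"
  shows "exp (branch z $ i) = z $ i"
proof -
  have "phase z i \<noteq> 0"
    using chart_dom_nonzero[OF assms] by (simp add: phase_def)
  then have "exp (branch z $ i) =
      exp (\<Psi> (\<rho> (ln_abs z)) $ i + \<i> * complex_of_real (\<theta> $ i)) * phase z i"
    using assms(2) by (simp add: branch_def off_nth exp_add)
  also have "\<dots> = z $ i"
    unfolding phase_def by (simp add: mult.left_commute[of _ "z $ i"] exp_add[symmetric])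
  finally show ?thesis .
qed

lemma cmod_phase:
  assumes "z \<in> chart_dom" "i \<notin> J"
  shows "cmod (phase z i) = 1"
proof -
  have "off J (Re\<Psi> (\<rho> (ln_abs z))) = ln_abs z"
    by (rule off_Re\<Psi>_\<rho>) (simp add: ln_abs_def off_nth)
  from arg_cong[OF this, of "\<lambda>y. y $ i"]
  have "Re (\<Psi> (\<rho> (ln_abs z)) $ i) = ln (cmod (z $ i))"
    using assms(2) by (simp add: off_nth ln_abs_def Re\<Psi>_def Re_vec_def)
  then show ?thesis
    using chart_dom_nonzero[OF assms] by (simp add: phase_def norm_mult exp_minus)
qed

lemma transversal_coords:
  assumes z: "z \<in> chart_dom"
  shows "L (coords z) = normal_form z" "transversal (coords z) = e (- \<alpha> (branch z)) * z"
proof -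
  have "off J (normal_form z) = branch z - off J (\<Psi> (\<alpha> (branch z)))"
    by (auto simp: vec_eq_iff normal_form_def off_nth branch_def)
  then have "\<alpha> (normal_form z) = 0"
    using \<alpha>_off[of "normal_form z"] by (simp add: \<alpha>_diff \<alpha>_off_\<Psi>)
  then show L: "L (coords z) = normal_form z"
    unfolding coords_def by (rule L_\<beta>)
  show "transversal (coords z) = e (- \<alpha> (branch z)) * z"
    unfolding transversal_def L using exp_branch[OF z]
    by (auto simp: vec_eq_iff normal_form_def e_nth \<Psi>_minus exp_diff exp_minus field_simps)
qed

lemma coords_in_coord_box:
  assumes z: "z \<in> chart_dom"
  shows "coords z \<in> coord_box"
proof -
  let ?w = "\<alpha> (branch z)"
  have Re_branch: "Re (branch z $ i) = Re\<Psi> (\<rho> (ln_abs z)) $ i" if "i \<notin> J" for i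
  proof -
    have "phase z i \<noteq> 0"
      using cmod_phase[OF z that] by auto
    then have "Re (Ln (phase z i)) = 0"
      using cmod_phase[OF z that] by simp
    then show ?thesis
      using that by (simp add: branch_def off_nth Re\<Psi>_def Re_vec_def)
  qed
  have "off J (Re_vec (normal_form z)) = off J (Re\<Psi> (\<rho> (ln_abs z) - ?w))"
    by (auto simp: vec_eq_iff off_nth Re_vec_def normal_form_def Re_branch Re\<Psi>_def \<Psi>_diff)
  then have \<rho>: "\<rho> (off J (Re_vec (L (coords z)))) = \<rho> (ln_abs z) - ?w"
    by (simp add: transversal_coords(1)[OF z] \<rho>_off_Re\<Psi>)
  have "angle (coords z) i = Im (Ln (phase z i))" if "i \<notin> J" for i
  proof -
    have "branch z $ i = \<Psi> (\<rho> (ln_abs z)) $ i + \<i> * complex_of_real (\<theta> $ i) + Ln (phase z i)"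
      using that by (simp add: branch_def off_nth)
    then show ?thesis
      unfolding angle_def \<rho> unfolding transversal_coords(1)[OF z]
      using that by (simp add: normal_form_def \<Psi>_diff)
  qed
  moreover have "\<bar>Im (Ln (phase z i))\<bar> < pi" if "i \<notin> J" for i
  proof -
    have "phase z i \<notin> \<real>\<^sub>\<le>\<^sub>0"
      using z that by (simp add: chart_dom_def)
    then have "phase z i \<noteq> 0" "Im (Ln (phase z i)) < pi"
      using Im_Ln_less_pi by auto
    then show ?thesis
      using mpi_less_Im_Ln[of "phase z i"] by (simp add: abs_less_iff)
  qed
  ultimately show ?thesis
    by (simp add: coord_box_def)
qed

lemma phase_transversal:
  assumes "i \<notin> J"
  shows "phase (transversal v) i = exp (\<i> * complex_of_real (angle v i))"
    and "\<rho> (ln_abs (transversal v)) = \<rho> (off J (Re_vec (L v)))"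
proof -
  have ln_abs: "ln_abs (transversal v) = off J (Re_vec (L v))"
    by (auto simp: ln_abs_def transversal_def vec_eq_iff off_nth Re_vec_def)
  then show \<rho>: "\<rho> (ln_abs (transversal v)) = \<rho> (off J (Re_vec (L v)))"
    by simp
  let ?w = "\<rho> (off J (Re_vec (L v)))"
  have "off J (Re\<Psi> ?w) = off J (Re_vec (L v))"
    by (rule off_Re\<Psi>_\<rho>) (simp add: off_nth)
  from arg_cong[OF this, of "\<lambda>y. y $ i"]
  have re: "Re (\<Psi> ?w $ i) = Re (L v $ i)"
    using assms by (simp add: off_nth Re\<Psi>_def Re_vec_def)
  have "transversal v $ i = exp (L v $ i)"
    using assms by (simp add: transversal_def)
  then have "phase (transversal v) i = exp (L v $ i + (- (\<Psi> ?w $ i) - \<i> * complex_of_real (\<theta> $ i)))"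
    by (simp add: phase_def \<rho> mult_exp_exp)
  also have "L v $ i + (- (\<Psi> ?w $ i) - \<i> * complex_of_real (\<theta> $ i)) = \<i> * complex_of_real (angle v i)"
    by (simp add: complex_eq_iff angle_def re)
  finally show "phase (transversal v) i = exp (\<i> * complex_of_real (angle v i))" .
qed

lemma transversal_in_chart_dom:
  assumes "v \<in> coord_box"
  shows "transversal v \<in> chart_dom"
proof -
  have "phase (transversal v) i \<notin> \<real>\<^sub>\<le>\<^sub>0" if "i \<notin> J" for i
  proof
    assume "phase (transversal v) i \<in> \<real>\<^sub>\<le>\<^sub>0"
    moreover have "\<bar>angle v i\<bar> < pi"
      using assms that by (simp add: coord_box_def)
    then have "Ln (phase (transversal v) i) = \<i> * complex_of_real (angle v i)"
      unfolding phase_transversal(1)[OF that] by (intro Ln_exp) auto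
    moreover have nz: "phase (transversal v) i \<noteq> 0"
      unfolding phase_transversal(1)[OF that] by simp
    ultimately have "Im (Ln (phase (transversal v) i)) = pi"
      unfolding Im_Ln_eq_pi[OF nz] by (auto simp: complex_nonpos_Reals_iff complex_eq_iff less_le)
    then show False
      using \<open>Ln _ = _\<close> \<open>\<bar>angle v i\<bar> < pi\<close> by simp
  qed
  then show ?thesis
    by (simp add: chart_dom_def transversal_def)
qed

lemma coords_transversal:
  assumes v: "v \<in> coord_box"
  shows "coords (transversal v) = v"
proof -
  have "branch (transversal v) $ i = L v $ i" if "i \<notin> J" for i
  proof -
    have "\<bar>angle v i\<bar> < pi"
      using v that by (simp add: coord_box_def)
    then have "Ln (phase (transversal v) i) = \<i> * complex_of_real (angle v i)"
      unfolding phase_transversal(1)[OF that] by (intro Ln_exp) auto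
    moreover have "exp (branch (transversal v) $ i) = exp (L v $ i)"
      using exp_branch[OF transversal_in_chart_dom[OF v] that] that by (simp add: transversal_def)
    moreover have "\<rho> (off J (Re_vec (L v))) = \<rho> (ln_abs (transversal v))"
      using phase_transversal(2)[OF that] by simp
    moreover have "Im (L v $ i) = angle v i + \<theta> $ i + Im (\<Psi> (\<rho> (off J (Re_vec (L v)))) $ i)"
      by (simp add: angle_def)
    ultimately have "Im (branch (transversal v) $ i) = Im (L v $ i)"
      using that by (simp add: branch_def off_nth)
    moreover have "exp (Re (branch (transversal v) $ i)) = exp (Re (L v $ i))"
      using arg_cong[OF \<open>exp _ = exp (L v $ i)\<close>, of cmod] by simp
    ultimately show ?thesis
      by (simp add: complex_eq_iff)
  qed
  then have branch: "branch (transversal v) = off J (L v)"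
    by (simp add: vec_eq_iff off_nth branch_def)
  have "transversal v $ i = L v $ i" if "i \<in> J" for i
    using that by (simp add: transversal_def)
  then have "normal_form (transversal v) = L v"
    by (simp add: normal_form_def branch \<alpha>_off \<alpha>_L \<Psi>_0 vec_eq_iff off_nth)
  then show ?thesis
    by (simp add: coords_def \<beta>_L)
qed

lemma continuous_\<rho>: "continuous_on S \<rho>"
  using linear_\<rho> by (simp add: linear_continuous_on linear_conv_bounded_linear)

lemma continuous_ln_abs:
  assumes "\<And>z i. z \<in> S \<Longrightarrow> i \<notin> J \<Longrightarrow> z $ i \<noteq> 0"
  shows "continuous_on S (\<lambda>z. \<Psi> (\<rho> (ln_abs z)) $ i)"
proof -
  have "continuous_on S ln_abs"
    unfolding ln_abs_def off_def
  proof (intro continuous_intros)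
    fix i
    show "continuous_on S (\<lambda>z. if i \<in> J then 0 else (\<chi> i. ln (cmod (z $ i))) $ i)"
      using assms by (cases "i \<in> J") (auto intro!: continuous_intros)
  qed
  then show ?thesis
    by (intro continuous_intros continuous_on_compose2[OF continuous_\<Psi>[of UNIV]]
        continuous_on_compose2[OF continuous_\<rho>[of UNIV]]) auto
qed

lemma continuous_phase:
  assumes "\<And>z i. z \<in> S \<Longrightarrow> i \<notin> J \<Longrightarrow> z $ i \<noteq> 0"
  shows "continuous_on S (\<lambda>z. phase z i)"
  unfolding phase_def by (intro continuous_intros continuous_ln_abs assms)

lemma open_chart_dom: "open chart_dom"
proof -
  define S where "S = {z::complex^'m. \<forall>i. i \<notin> J \<longrightarrow> z $ i \<noteq> 0}"
  have "S = (\<Inter>i\<in>- J. {z. z $ i \<noteq> 0})"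
    by (auto simp: S_def)
  then have "open S"
    by (auto intro!: open_INT open_Collect_neq continuous_intros)
  moreover have "continuous_on S (\<lambda>z. phase z i)" for i
    by (rule continuous_phase) (simp add: S_def)
  ultimately have "open (S \<inter> (\<lambda>z. phase z i) -` (- \<real>\<^sub>\<le>\<^sub>0))" for i
    by (intro continuous_open_preimage) (auto simp: open_Compl)
  then have "open (S \<inter> (\<Inter>i\<in>- J. S \<inter> (\<lambda>z. phase z i) -` (- \<real>\<^sub>\<le>\<^sub>0)))"
    using \<open>open S\<close> by (intro open_Int open_INT) auto
  moreover have "chart_dom = S \<inter> (\<Inter>i\<in>- J. S \<inter> (\<lambda>z. phase z i) -` (- \<real>\<^sub>\<le>\<^sub>0))"
    by (auto simp: chart_dom_def S_def)
  ultimately show ?thesis by simp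
qed

lemma cdiff_branch:
  assumes z: "z \<in> chart_dom"
  shows "cdiff (\<lambda>u. branch u $ i) z"
proof (cases "i \<in> J")
  case True
  then show ?thesis
    using cdiff_const[of 0] by (simp add: branch_def off_nth)
next
  case False
  have "continuous_on chart_dom (\<lambda>u. \<Psi> (\<rho> (ln_abs u)) $ i + \<i> * complex_of_real (\<theta> $ i) + Ln (phase u i))"
    using False by (intro continuous_intros continuous_ln_abs continuous_phase chart_dom_nonzero) (auto simp: chart_dom_def)
  then have "continuous_on chart_dom (\<lambda>u. branch u $ i)"
    using False by (simp add: branch_def off_nth)
  then have "isCont (\<lambda>u. branch u $ i) z"
    using open_chart_dom z by (simp add: continuous_on_eq_continuous_at)
  moreover have "\<forall>\<^sub>F u in nhds z. exp (branch u $ i) = u $ i"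
    using eventually_nhds_in_open[OF open_chart_dom z] by eventually_elim (rule exp_branch[OF _ False])
  ultimately show ?thesis
    by (rule cdiff_continuous_log)
qed

lemma holomorphic_coords: "holomorphic_map_on (*s) (*s) coords chart_dom"
  unfolding holomorphic_map_on_def
proof
  fix z assume z: "z \<in> chart_dom"
  have \<Psi>\<alpha>: "cdiff (\<lambda>u. \<Psi> (\<alpha> (branch u)) $ i) z" for i
    by (intro cdiff_linear[OF linear_\<Psi>] cdiff_linear[OF linear_\<alpha>] cdiff_branch z)
  have "cdiff (\<lambda>u. normal_form u $ i) z" for i
  proof (cases "i \<in> J")
    case True
    have "cdiff (\<lambda>u. exp (0 - \<Psi> (\<alpha> (branch u)) $ i) * u $ i) z"
      by (intro cdiff_mult cdiff_exp cdiff_diff cdiff_const \<Psi>\<alpha> cdiff_nth)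
    then show ?thesis
      using True by (simp add: normal_form_def)
  next
    case False
    have "cdiff (\<lambda>u. branch u $ i - \<Psi> (\<alpha> (branch u)) $ i) z"
      by (intro cdiff_diff \<Psi>\<alpha> cdiff_branch z)
    then show ?thesis
      using False by (simp add: normal_form_def)
  qed
  then show "\<exists>D. complex_derivative (*s) (*s) coords D z"
    unfolding coords_def by (intro complex_derivative_componentwise cdiff_linear[OF linear_\<beta>])
qed

lemma holomorphic_transversal: "holomorphic_map_on (*s) (*s) transversal S"
  unfolding holomorphic_map_on_def
proof
  fix v assume "v \<in> S"
  have L: "cdiff (\<lambda>u. L u $ i) v" for i
    by (intro cdiff_linear[OF linear_L, of "\<lambda>u. u"] cdiff_nth)
  have "cdiff (\<lambda>u. transversal u $ i) v" for i
    using L cdiff_exp[OF L] by (cases "i \<in> J") (simp_all add: transversal_def)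
  then show "\<exists>D. complex_derivative (*s) (*s) transversal D v"
    by (rule complex_derivative_componentwise)
qed

lemma open_coord_box: "open coord_box"
proof -
  have "continuous_on UNIV L"
    by (rule linear_continuous_on[OF vec_linear_imp_bounded_linear[OF linear_L]])
  moreover have "continuous_on UNIV (\<lambda>v. off J (Re_vec (L v)))"
    using \<open>continuous_on UNIV L\<close> unfolding Re_vec_def
    by (intro continuous_on_compose2[OF linear_continuous_on[OF
            linear_off_real[of J, unfolded linear_conv_bounded_linear], of UNIV]] continuous_intros) auto
  ultimately have "continuous_on UNIV (\<lambda>v. angle v i)" for i
    unfolding angle_def
    by (intro continuous_intros continuous_on_compose2[OF continuous_\<Psi>[of UNIV]]
        continuous_on_compose2[OF continuous_\<rho>[of UNIV]]) auto
  then have "open (\<Inter>i\<in>- J. {v. \<bar>angle v i\<bar> < pi})"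
    by (intro open_INT ballI open_Collect_less continuous_intros) auto
  moreover have "coord_box = (\<Inter>i\<in>- J. {v. \<bar>angle v i\<bar> < pi})"
    by (auto simp: coord_box_def)
  ultimately show ?thesis by simp
qed

theorem invariant_chart_coords: "invariant_chart chart_dom coords coord_box transversal"
proof -
  have "coords ` chart_dom \<subseteq> coord_box" "transversal ` coord_box \<subseteq> chart_dom"
    using coords_in_coord_box transversal_in_chart_dom by blast+
  moreover have "\<exists>w. transversal (coords z) = e w * z" if "z \<in> chart_dom" for z
    using transversal_coords(2)[OF that] by blast
  ultimately show ?thesis
    unfolding invariant_chart_def
    using open_chart_dom saturated_chart_dom coords_e_mult holomorphic_coords open_coord_box holomorphic_transversal
      coords_transversal
    by (intro conjI allI ballI)
qed

end

section \<open>The complex structure on the quotient\<close>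

context admissible_polytope
begin

text \<open>Outside a vertex \<open>J\<close> that contains the zeros of \<open>z\<close> there are as many coordinates as the group
  has real dimensions.  So the absolute values there determine the group element, and \<open>\<rho>\<close> is an
  inverse.  With the reference angles taken from \<open>z\<close> itself, the phases of \<open>z\<close> are positive.\<close>

lemma invariant_chart_at:
  assumes z: "z \<in> U" and card_d: "CARD('d::finite) = dim E + CARD('l)"
  shows "\<exists>O' (p :: complex^'m \<Rightarrow> complex^'d) V \<sigma>. invariant_chart O' p V \<sigma> \<and> z \<in> O'"
proof -
  obtain J where J: "{i. z $ i = 0} \<subseteq> J" "J \<in> K" "card J = dim E"
    using z extend_to_vertex unfolding U_iff by metis
  define F where "F = (\<lambda>w. off J (Re\<Psi> w))"
  have F: "linear F"
    using linear_compose[OF linear_Re\<Psi> linear_off_real[of J]] by (simp add: F_def comp_def)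
  have F0: "w = 0" if "F w = 0" for w
  proof -
    have "Re\<Psi> w = 0"
    proof (rule N_supported_zero_K[OF _ J(2)])
      show "Re\<Psi> w \<in> N"
        using range_Re\<Psi> by blast
      show "Re\<Psi> w $ i = 0" if "i \<notin> J" for i
        using arg_cong[OF \<open>F w = 0\<close>, of "\<lambda>y. y $ i"] that by (simp add: F_def off_nth)
    qed
    then show ?thesis
      using inj_Re\<Psi> linear_Re\<Psi> by (simp add: linear_injective_0)
  qed
  then have inj_F: "inj F"
    using F by (simp add: linear_injective_0)
  obtain \<rho> where \<rho>: "linear \<rho>" "\<rho> \<circ> F = id"
    using linear_injective_left_inverse[OF F inj_F] by blast
  have \<rho>F: "\<rho> (F w) = w" for w
    using \<rho>(2) by (metis comp_apply id_apply)
  have "range F = {y. \<forall>i. i \<notin> - J \<longrightarrow> y $ i = 0}" (is "_ = ?V")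
  proof (rule subspace_dim_equal)
    show "subspace (range F)"
      by (rule linear_subspace_image[OF F subspace_UNIV])
    show "subspace ?V"
      by (auto simp: subspace_def)
    show "range F \<subseteq> ?V"
      by (auto simp: F_def off_nth)
    have "dim ?V = card (- J)"
      using dim_substandard_cart[where 'a = real, of "- J"] by (simp only: dim_vec_eq)
    moreover have "dim (range F) = 2 * CARD('l)"
      using dim_image_eq[OF F, of UNIV] inj_F by simp
    ultimately show "dim ?V \<le> dim (range F)"
      using J(3) card_m by (simp add: Compl_eq_Diff_UNIV card_Diff_subset)
  qed
  then have F\<rho>: "F (\<rho> y) = y" if "\<And>i. i \<in> J \<Longrightarrow> y $ i = 0" for y
  proof -
    have "y \<in> range F"
      using that \<open>range F = ?V\<close> by simp
    then show ?thesis
      using \<rho>F by auto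
  qed
  define A where "A = (\<lambda>w. off J (\<Psi> w))"
  have A: "Vector_Spaces.linear (*s) (*s) A"
    using Vector_Spaces.linear_compose[OF linear_\<Psi> linear_off[of J]] by (simp add: A_def comp_def)
  have "inj A"
  proof (rule injI)
    fix v w assume "A v = A w"
    then have "Re_vec (A v) = Re_vec (A w)"
      by simp
    then have "F v = F w"
      by (simp add: A_def F_def Re\<Psi>_def Re_vec_def off_def vec_eq_iff)
        (metis zero_complex.simps(1))
    then show "v = w"
      using inj_F by (simp add: inj_eq)
  qed
  then obtain \<alpha>0 where \<alpha>0: "Vector_Spaces.linear (*s) (*s) \<alpha>0" "\<alpha>0 \<circ> A = id"
    using vec.linear_injective_left_inverse[OF A] by blast
  define \<alpha> where "\<alpha> = (\<lambda>x. \<alpha>0 (off J x))"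
  have \<alpha>: "Vector_Spaces.linear (*s) (*s) \<alpha>"
    using Vector_Spaces.linear_compose[OF linear_off[of J] \<alpha>0(1)] by (simp add: \<alpha>_def comp_def)
  have off_off: "off J (off J x) = off J x" for x :: "complex^'m"
    by (simp add: off_def vec_eq_iff)
  have \<alpha>A: "\<alpha> (A w) = w" for w
    using \<alpha>0(2) by (metis A_def \<alpha>_def comp_apply id_apply off_off)
  have "CARD('m) = CARD('l) + CARD('d)"
    using card_m card_d by simp
  then obtain L :: "complex^'d \<Rightarrow> complex^'m" and \<beta> where L: "Vector_Spaces.linear (*s) (*s) L"
    "Vector_Spaces.linear (*s) (*s) \<beta>" "\<And>v. \<beta> (L v) = v" "\<And>v. \<alpha> (L v) = 0"
    "\<And>x. \<alpha> x = 0 \<Longrightarrow> L (\<beta> x) = x"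
    using kernel_of_retraction[OF A \<alpha> \<alpha>A] by blast
  have chart: "vertex_chart E a b \<Psi> J \<rho> \<alpha> L \<beta>"
  proof (intro vertex_chart.intro vertex_chart_axioms.intro admissible_polytope_axioms)
    show "\<rho> (off J (Re\<Psi> w)) = w" for w
      using \<rho>F by (simp add: F_def)
    show "off J (Re\<Psi> (\<rho> y)) = y" if "\<And>i. i \<in> J \<Longrightarrow> y $ i = 0" for y
      using F\<rho>[OF that] by (simp add: F_def)
    show "\<alpha> (off J (\<Psi> w)) = w" for w
      using \<alpha>A by (simp add: A_def)
    show "\<alpha> (off J x) = \<alpha> x" for x
      by (simp add: \<alpha>_def off_off)
  qed (fact J(2) \<rho>(1) \<alpha> L)+
  define \<zeta> where "\<zeta> = (\<lambda>i. z $ i * exp (- (\<Psi> (\<rho> (vertex_chart.ln_abs J z)) $ i)))"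
  interpret c: vertex_chart E a b \<Psi> J "\<chi> i. Im (Ln (\<zeta> i))" \<rho> \<alpha> L \<beta>
    by (rule chart)
  have "z \<in> c.chart_dom"
  proof -
    have nz: "z $ i \<noteq> 0" if "i \<notin> J" for i
      using that J(1) by blast
    have "c.phase z i = complex_of_real (exp (Re (Ln (\<zeta> i))))" if "i \<notin> J" for i
    proof -
      have "\<zeta> i \<noteq> 0"
        using nz[OF that] by (simp add: \<zeta>_def)
      have "c.phase z i = \<zeta> i * exp (- (\<i> * complex_of_real (Im (Ln (\<zeta> i)))))"
        by (simp only: c.phase_def) (simp add: \<zeta>_def mult.assoc mult_exp_exp)
      also have "\<dots> = exp (Ln (\<zeta> i) - \<i> * complex_of_real (Im (Ln (\<zeta> i))))"
        using \<open>\<zeta> i \<noteq> 0\<close> by (simp add: exp_diff exp_minus divide_inverse)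
      also have "Ln (\<zeta> i) - \<i> * complex_of_real (Im (Ln (\<zeta> i))) = complex_of_real (Re (Ln (\<zeta> i)))"
        by (simp add: complex_eq_iff)
      finally show ?thesis
        by (simp add: exp_of_real)
    qed
    then show ?thesis
      using nz by (simp add: c.chart_dom_def)
  qed
  then show ?thesis
    using c.invariant_chart_coords by blast
qed

theorem complex_structure_on_homeomorph:
  assumes f: "homeomorphic_map Y (top_of_set Z) f"
    and card_d: "CARD('d::finite) = dim E + CARD('l)"
  shows "\<exists>(Q :: ((complex^'m) set, 'd) chart set) h.
     complex_structure_as_quotient Y U (exp_vec \<circ> \<Psi>) Q h"
proof -
  let ?Q = "quotient_charts :: ((complex^'m) set, 'd) chart set"
  have cover: "\<exists>O' (p :: complex^'m \<Rightarrow> complex^'d) V \<sigma>. invariant_chart O' p V \<sigma> \<and> z \<in> O'"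
    if "z \<in> U" for z
    using invariant_chart_at[OF that card_d] .
  have Q: "complex_manifold X ?Q"
    using complex_atlas_quotient(1)[OF cover] Hausdorff_X second_countable_X
    by (simp add: complex_manifold_def)
  have h: "homeomorphic_map Y X (q \<circ> f)"
    using homeomorphic_map_compose[OF f] homeomorphic_map_slice by (simp add: slice_eq_Z)
  have "complex_structure_as_quotient Y U e ?Q (q \<circ> f)"
    unfolding complex_structure_as_quotient_def
    using free_proper_holomorphic Q complex_atlas_quotient(2)[OF cover] h
      complex_manifold_transported[OF h Q]
    by (intro conjI)
  then show ?thesis
    unfolding e_def by blast
qed

end

section \<open>Existence of admissible maps\<close>

text \<open>A real linear isomorphism of \<open>complex^'l\<close> onto the kernel of the fan map is the real part
  of exactly one complex linear map.\<close>

lemma (in generic_polytope) admissible_exists: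
  assumes card: "CARD('m) = dim E + 2 * CARD('l::finite)"
  shows "\<exists>\<Psi> :: complex^'l \<Rightarrow> complex^'m. admissible_Psi E a b \<Psi>"
proof -
  have "dim (UNIV :: (complex^'l) set) = dim N"
    using dim_N card by simp
  then obtain f :: "complex^'l \<Rightarrow> real^'m" where f: "linear f" "range f = N" "inj f"
    using subspace_isomorphism[OF subspace_UNIV subspace_N] by metis
  define \<Psi> where "\<Psi> = (\<lambda>w. \<chi> i. Complex (f w $ i) (- (f (\<i> *s w) $ i)))"
  have f_add: "f (x + y) = f x + f y" and f_scale: "f (r *\<^sub>R x) = r *\<^sub>R f x" for x y r
    using f(1) by (simp_all add: linear_add linear_scale)
  have f_complex: "f (c *s w) = Re c *\<^sub>R f w + Im c *\<^sub>R f (\<i> *s w)" for c w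
  proof -
    have "c *s w = Re c *\<^sub>R w + Im c *\<^sub>R (\<i> *s w)"
      by (simp add: vec_eq_iff complex_eq_iff)
    then show ?thesis
      by (simp only: f_add f_scale)
  qed
  have "Vector_Spaces.linear (*s) (*s) \<Psi>"
    unfolding vec_linear_iff
  proof (intro conjI allI)
    show "\<Psi> (x + y) = \<Psi> x + \<Psi> y" for x y
      by (simp add: \<Psi>_def vec_eq_iff f_add vec.scale_right_distrib complex_eq_iff)
    show "\<Psi> (c *s x) = c *s \<Psi> x" for c x
      using f_complex[of c x] f_complex[of "\<i> * c" x]
      by (simp add: \<Psi>_def vec_eq_iff complex_eq_iff)
  qed
  moreover have Re: "Re_vec (\<Psi> w) = f w" for w
    by (simp add: \<Psi>_def Re_vec_def vec_eq_iff)
  then have "inj (Re_vec \<circ> \<Psi>)"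
    using f(3) by (simp add: inj_def)
  moreover have "fan_map E a b (Re_vec (\<Psi> w)) = 0" for w
    using f(2) Re by (auto simp: N_def)
  ultimately show ?thesis
    unfolding admissible_Psi_def by blast
qed

section \<open>Adding a trivial inequality\<close>

text \<open>The new index has slack \<open>1\<close> everywhere.  It is a ghost, and the coordinate of \<open>Z\<close> that belongs to
  it runs through the unit circle.\<close>

lemma presented_polytope_trivial:
  "presented_polytope E (add_trivial_normal a) (add_trivial_const b) = presented_polytope E a b"
  by (auto simp: presented_polytope_def add_trivial_normal_def add_trivial_const_def split: option.splits)

lemma generic_presentation_trivial:
  assumes "generic_presentation E a b"
  shows "generic_presentation E (add_trivial_normal a) (add_trivial_const b)"
proof -
  have "{i. x \<in> pres_hyperplane E (add_trivial_normal a) (add_trivial_const b) i}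
      = Some ` {i. x \<in> pres_hyperplane E a b i}" for x
    by (auto simp: pres_hyperplane_def add_trivial_normal_def add_trivial_const_def image_iff
        split: option.splits)
  then show ?thesis
    using assms by (simp add: generic_presentation_def presented_polytope_trivial card_image)
qed

lemma moment_angle_manifold_trivial:
  "y \<in> moment_angle_manifold E (add_trivial_normal a) (add_trivial_const b) \<longleftrightarrow>
     (\<chi> j. y $ Some j) \<in> moment_angle_manifold E a b \<and> cmod (y $ None) = 1"
proof -
  have "(cmod (y $ None))\<^sup>2 = 1 \<longleftrightarrow> cmod (y $ None) = 1"
    unfolding power2_eq_1_iff using norm_ge_zero[of "y $ None"] by linarith
  then have "(\<chi> i. (cmod (y $ i))\<^sup>2) = polytope_map (add_trivial_normal a) (add_trivial_const b) x \<longleftrightarrow>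
      (\<chi> i. (cmod (y $ Some i))\<^sup>2) = polytope_map a b x \<and> cmod (y $ None) = 1" for x
    by (simp add: vec_eq_iff polytope_map_def split_option_all add_trivial_normal_def
        add_trivial_const_def conj_commute)
  then show ?thesis
    by (auto simp: moment_angle_manifold_def presented_polytope_trivial image_iff)
qed

definition append_coord :: "(complex^'m::finite) \<times> complex \<Rightarrow> complex^('m option)" where
  "append_coord y = (\<chi> i. case i of None \<Rightarrow> snd y | Some j \<Rightarrow> fst y $ j)"

lemma homeomorphic_map_append_coord:
  fixes a :: "'m::finite \<Rightarrow> 'v::euclidean_space"
  shows "homeomorphic_map (prod_topology (top_of_set (moment_angle_manifold E a b))
      (top_of_set (sphere (0::complex) 1)))
     (top_of_set (moment_angle_manifold E (add_trivial_normal a) (add_trivial_const b))) append_coord"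
proof -
  let ?Z = "moment_angle_manifold E a b"
  let ?Z' = "moment_angle_manifold E (add_trivial_normal a) (add_trivial_const b)"
  let ?g = "\<lambda>y::complex^('m option). ((\<chi> j. y $ Some j), y $ None)"
  have inv: "?g (append_coord y) = y" "append_coord (?g z) = z" for y and z :: "complex^('m option)"
    by (simp_all add: append_coord_def vec_eq_iff prod_eq_iff split: option.split)
  have "continuous_on S (append_coord :: (complex^'m) \<times> complex \<Rightarrow> _)" for S
    unfolding append_coord_def
  proof (intro continuous_on_vec_lambda)
    fix i :: "'m option"
    show "continuous_on S (\<lambda>y. case i of None \<Rightarrow> snd y | Some j \<Rightarrow> fst y $ j)"
      by (cases i) (auto intro!: continuous_intros)
  qed
  moreover have "continuous_on S ?g" for S
    by (intro continuous_intros)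
  moreover have "append_coord y \<in> ?Z'" if "y \<in> ?Z \<times> sphere 0 1" for y
    using that by (auto simp: moment_angle_manifold_trivial append_coord_def)
  moreover have "?g z \<in> ?Z \<times> sphere 0 1" if "z \<in> ?Z'" for z
    using that by (auto simp: moment_angle_manifold_trivial)
  ultimately have "homeomorphic_maps (top_of_set (?Z \<times> sphere 0 1)) (top_of_set ?Z') append_coord ?g"
    using inv by (auto simp: homeomorphic_maps_def)
  then show ?thesis
    using homeomorphic_map_maps
    by (fastforce simp: subtopology_Times[symmetric] euclidean_product_topology)
qed

theorem corollary4p7:
  fixes E :: "'v::euclidean_space set"
    and a :: "'m::finite \<Rightarrow> 'v"
    and b :: "'m \<Rightarrow> real"
  assumes "subspace E" and "range a \<subseteq> E"
    and "polytope (presented_polytope E a b)"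
    and "aff_dim (presented_polytope E a b) = int (dim E)"
    and "generic_presentation E a b"
    and "CARD('d::finite) = dim E + CARD('l::finite)"
  shows
    "(even (CARD('m) + dim E) \<and> CARD('m) = dim E + 2 * CARD('l) \<longrightarrow>
        (\<exists>\<Psi> :: complex^'l \<Rightarrow> complex^'m. admissible_Psi E a b \<Psi>) \<and>
        (\<forall>\<Psi> :: complex^'l \<Rightarrow> complex^'m. admissible_Psi E a b \<Psi> \<longrightarrow>
          (\<exists>(Q :: ((complex^'m) set, 'd) chart set) h.
            complex_structure_as_quotient
              (top_of_set (moment_angle_manifold E a b))
              (coord_arrangement_complement (polytope_complex E a b))
              (exp_vec \<circ> \<Psi>) Q h))) \<and>
     (odd (CARD('m) + dim E) \<and> CARD('m) + 1 = dim E + 2 * CARD('l) \<longrightarrow>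
        (let a' = add_trivial_normal a; b' = add_trivial_const b in
        (\<exists>\<Psi> :: complex^'l \<Rightarrow> complex^('m option). admissible_Psi E a' b' \<Psi>) \<and>
        (\<forall>\<Psi> :: complex^'l \<Rightarrow> complex^('m option). admissible_Psi E a' b' \<Psi> \<longrightarrow>
          (\<exists>(Q :: ((complex^('m option)) set, 'd) chart set) h.
            complex_structure_as_quotient
              (prod_topology (top_of_set (moment_angle_manifold E a b))
                 (top_of_set (sphere (0::complex) 1)))
              (coord_arrangement_complement (polytope_complex E a' b'))
              (exp_vec \<circ> \<Psi>) Q h))))"
proof -
  have nonempty: "presented_polytope E a b \<noteq> {}"
    using assms(4) by (metis aff_dim_empty of_nat_0_le_iff neg_0_le_iff_le not_one_le_zero)
  have P: "generic_polytope E a b"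
    using assms nonempty polytope_imp_compact by unfold_locales auto
  have P': "generic_polytope E (add_trivial_normal a) (add_trivial_const b)"
  proof
    show "add_trivial_normal a i \<in> E" for i
      using assms(1,2) by (auto simp: add_trivial_normal_def subspace_0 split: option.split)
  qed (use assms nonempty polytope_imp_compact in
      \<open>auto simp: presented_polytope_trivial intro: generic_presentation_trivial\<close>)
  show ?thesis
    unfolding Let_def
  proof (intro conjI impI allI; elim conjE)
    assume card: "CARD('m) = dim E + 2 * CARD('l)"
    show "\<exists>\<Psi> :: complex^'l \<Rightarrow> complex^'m. admissible_Psi E a b \<Psi>"
      using generic_polytope.admissible_exists[OF P card] .
    fix \<Psi> :: "complex^'l \<Rightarrow> complex^'m" assume "admissible_Psi E a b \<Psi>"
    then interpret admissible_polytope E a b \<Psi>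
      using P card by (simp add: admissible_polytope_def admissible_polytope_axioms_def)
    show "\<exists>(Q :: ((complex^'m) set, 'd) chart set) h. complex_structure_as_quotient
        (top_of_set (moment_angle_manifold E a b))
        (coord_arrangement_complement (polytope_complex E a b)) (exp_vec \<circ> \<Psi>) Q h"
      by (rule complex_structure_on_homeomorph[OF homeomorphic_map_id[THEN iffD2, OF refl] assms(6)])
  next
    let ?a = "add_trivial_normal a" and ?b = "add_trivial_const b"
    assume "CARD('m) + 1 = dim E + 2 * CARD('l)"
    then have card: "CARD('m option) = dim E + 2 * CARD('l)"
      by simp
    show "\<exists>\<Psi> :: complex^'l \<Rightarrow> complex^('m option). admissible_Psi E ?a ?b \<Psi>"
      using generic_polytope.admissible_exists[OF P' card] .
    fix \<Psi> :: "complex^'l \<Rightarrow> complex^('m option)" assume "admissible_Psi E ?a ?b \<Psi>"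
    then interpret admissible_polytope E ?a ?b \<Psi>
      using P' card by (simp add: admissible_polytope_def admissible_polytope_axioms_def)
    show "\<exists>(Q :: ((complex^('m option)) set, 'd) chart set) h. complex_structure_as_quotient
        (prod_topology (top_of_set (moment_angle_manifold E a b)) (top_of_set (sphere (0::complex) 1)))
        (coord_arrangement_complement (polytope_complex E ?a ?b)) (exp_vec \<circ> \<Psi>) Q h"
      by (rule complex_structure_on_homeomorph[OF homeomorphic_map_append_coord assms(6)])
  qed
qed

end
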